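(* Let $q\ge1$ and $x_0\in\mathbb R^d$. For every $(\beta,p,\mathcal P)\in(0,+\infty)^d\times[1,\infty]^d\times\mathfrak P$ and every $L\in(0,\infty)^d$ there exists $c>0$ such that $$\liminf_{n\to+\infty}\Big\{\rho_n^{-1}(\beta,p,\mathcal P)\inf_{\widetilde f_n}\mathcal R_n^{(q)}\big[\widetilde f_n,N^*_{p,d}(\beta,L,\mathcal P)\big]\Big\}\ge c,$$ where the infimum is taken over all possible estimators.
   Context: **Setting.** $X_1,X_2,\dots$ are i.i.d. $\mathbb R^d$-valued random vectors with density $f$ with respect to Lebesgue measure; $X^{(n)}=(X_1,\dots,X_n)$, $\mathbb E_f^{(n)}$ is the expectation under the law of $X^{(n)}$. An estimator is any $X^{(n)}$-measurable map. For a set $\Sigma$ of densities, $\mathcal R_n^{(q)}[\widehat f,\Sigma]=\sup_{f\in\Sigma}(\mathbb E_f^{(n)}|\widehat f(x_0)-f(x_0)|^q)^{1/q}$. **Partitions.** $\mathcal I_d$ is the set of (non-empty) subsets of $\{1,\dots,d\}$ and $\mathfrak P$ the set of all partitions of $\{1,\dots,d\}$; for $I\in\mathcal I_d$, $x_I=(x_i)_{i\in I}$ (similarly $\beta_I,p_I,L_I$) and $f_I(x_I)=\int f(x)\,dx_{\overline I}$, $\overline I=\{1,\dots,d\}\setminus I$, is the marginal density. **Nikolskii class.** For $p\in[1,\infty]^s$, $\beta,L\in(0,\infty)^s$, $\mathbb N_{p,s}(\beta,L)$ is the set of functions $f:\mathbb R^s\to\mathbb R$ such that for all $i=1,\dots,s$: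 (i) $\|D_i^kf\|_{p_i}\le L_i$ for all $k=0,\dots,\lfloor\beta_i\rfloor$; (ii) $\|D_i^{\lfloor\beta_i\rfloor}f(\cdot+te_i)-D_i^{\lfloor\beta_i\rfloor}f(\cdot)\|_{p_i}\le L_i|t|^{\beta_i-\lfloor\beta_i\rfloor}$ for all $t\in\mathbb R$. Here $D_i^kf$ is the $k$-th order partial derivative in the $i$-th variable, $(e_i)$ the canonical basis, and $\lfloor\beta_i\rfloor$ the largest integer strictly less than $\beta_i$. **Class with independence structure.** $N^*_{p,d}(\beta,L,\mathcal P)$ is the set of probability densities $f$ on $\mathbb R^d$ such that $f(x)=\prod_{I\in\mathcal P}f_I(x_I)$ for all $x\in\mathbb R^d$ and $f_I\in\mathbb N_{p_I,|I|}(\beta_I,L_I)$ for all $I\in\mathcal I_d$. **Rates.** $\gamma_I(\beta,p)=\dfrac{1-\sum_{i\in I}\frac1{\beta_ip_i}}{\sum_{i\in I}\frac1{\beta_i}}$, $r=r(\beta,p,\mathcal P)=\inf_{I\in\mathcal P}\gamma_I(\beta,p)$, $\varphi_n(\beta,p,\mathcal P)=(1/n)^{r/(2r+1)}$, and $\rho_n(\beta,p,\mathcal P)=\mathbf 1_{\{r\le0\}}+\varphi_n(\beta,p,\mathcal P)\mathbf 1_{\{r>0\}}$.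
   Formalization: The class N*_{p,d}(β,L,P) is additionally assumed to be non-empty; it is empty exactly when p_i = 1 and L_i < 1 for some i (since then ‖f‖_1 = 1 > L_i), and there the stated bound fails because the supremum over the class is 0. *)

theory Defs
  imports "HOL-Probability.Probability"
begin

section \<open>Coordinate spaces and norms\<close>

text \<open>
  The space of vectors \<open>(x\<^sub>i)\<^sub>i\<^sub>\<in>\<^sub>I\<close> with Lebesgue measure.  The carrier consists of the functions that are
  \<^const>\<open>undefined\<close> outside \<open>I\<close>, so \<open>x\<^sub>I\<close> is \<open>restrict x I\<close>, and
  \<open>\<real>\<^sup>d\<close> is the case \<open>I = {1..d}\<close>.
\<close>

abbreviation leb :: "nat set \<Rightarrow> (nat \<Rightarrow> real) measure" where
  "leb I \<equiv> PiM I (\<lambda>_. lborel)"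

definition epowr :: "ennreal \<Rightarrow> real \<Rightarrow> ennreal" where
  "epowr a s = (if a = \<infinity> then \<infinity> else ennreal (enn2real a powr s))"

definition Lp_norm :: "'a measure \<Rightarrow> ennreal \<Rightarrow> ('a \<Rightarrow> real) \<Rightarrow> ennreal" where
  "Lp_norm M p g =
     (if p = \<infinity> then esssup M (\<lambda>x. ennreal \<bar>g x\<bar>)
      else epowr (\<integral>\<^sup>+ x. ennreal (\<bar>g x\<bar> powr enn2real p) \<partial>M) (1 / enn2real p))"

section \<open>Nikolskii classes\<close>

text \<open>The largest integer strictly less than \<open>b\<close>; it is a natural number for \<open>b > 0\<close>.\<close>

definition sfloor :: "real \<Rightarrow> nat" where
  "sfloor b = nat (\<lceil>b\<rceil> - 1)"

definition pderiv_i :: "nat \<Rightarrow> nat \<Rightarrow> ((nat \<Rightarrow> real) \<Rightarrow> real) \<Rightarrow> (nat \<Rightarrow> real) \<Rightarrow> real" where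
  "pderiv_i i k g x = (deriv ^^ k) (\<lambda>t. g (x(i := t))) (x i)"

text \<open>
  The \<open>s\<close> coordinates are indexed by a finite set \<open>I\<close> with \<open>s\<close> elements.  The derivatives are classical.
  Since \<^const>\<open>deriv\<close> is total, the existence of the derivatives up to
  order \<open>sfloor (\<beta> i)\<close> is a separate requirement.
\<close>

definition nikolskii ::
  "nat set \<Rightarrow> (nat \<Rightarrow> ennreal) \<Rightarrow> (nat \<Rightarrow> real) \<Rightarrow> (nat \<Rightarrow> real) \<Rightarrow> ((nat \<Rightarrow> real) \<Rightarrow> real) set" where
  "nikolskii I p \<beta> L =
     {g \<in> borel_measurable (leb I). \<forall>i\<in>I.
        (\<forall>k<sfloor (\<beta> i). \<forall>x\<in>space (leb I). \<forall>t.
           (deriv ^^ k) (\<lambda>u. g (x(i := u))) field_differentiable at t) \<and>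
        (\<forall>k\<le>sfloor (\<beta> i). Lp_norm (leb I) (p i) (pderiv_i i k g) \<le> ennreal (L i)) \<and>
        (\<forall>t. Lp_norm (leb I) (p i)
               (\<lambda>x. pderiv_i i (sfloor (\<beta> i)) g (x(i := x i + t)) - pderiv_i i (sfloor (\<beta> i)) g x)
             \<le> ennreal (L i * \<bar>t\<bar> powr (\<beta> i - real (sfloor (\<beta> i)))))}"

section \<open>Densities with independence structure\<close>

definition prob_densities :: "nat \<Rightarrow> ((nat \<Rightarrow> real) \<Rightarrow> real) set" where
  "prob_densities d =
     {f \<in> borel_measurable (leb {1..d}).
        (\<forall>x\<in>space (leb {1..d}). 0 \<le> f x) \<and> (\<integral>\<^sup>+ x. ennreal (f x) \<partial>leb {1..d}) = 1}"

definition marginal :: "nat \<Rightarrow> nat set \<Rightarrow> ((nat \<Rightarrow> real) \<Rightarrow> real) \<Rightarrow> (nat \<Rightarrow> real) \<Rightarrow> real" where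
  "marginal d I f x = (\<integral>y. f (merge I ({1..d} - I) (x, y)) \<partial>leb ({1..d} - I))"

text \<open>
  Membership of \<open>f\<^sub>I\<close> in a class of real-valued functions presupposes that the
  integral defining \<open>f\<^sub>I\<close> exists at every point; as the Bochner integral is total, this is
  stated explicitly.
\<close>

definition nikolskii_indep ::
  "nat \<Rightarrow> (nat \<Rightarrow> ennreal) \<Rightarrow> (nat \<Rightarrow> real) \<Rightarrow> (nat \<Rightarrow> real) \<Rightarrow> nat set set
    \<Rightarrow> ((nat \<Rightarrow> real) \<Rightarrow> real) set" where
  "nikolskii_indep d p \<beta> L \<P> =
     {f \<in> prob_densities d.
        (\<forall>x\<in>space (leb {1..d}). f x = (\<Prod>I\<in>\<P>. marginal d I f (restrict x I))) \<and>
        (\<forall>I. I \<subseteq> {1..d} \<and> I \<noteq> {} \<longrightarrow>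
           (\<forall>x\<in>space (leb I).
              integrable (leb ({1..d} - I)) (\<lambda>y. f (merge I ({1..d} - I) (x, y)))) \<and>
           marginal d I f \<in> nikolskii I p \<beta> L)}"

text \<open>
  The bound for \<open>k = 0\<close> includes the \<open>L\<^sup>1\<close> norm of the density itself whenever \<open>p i = 1\<close>, so the
  class can be empty for small \<open>L\<close>.
\<close>

lemma nikolskii_indep_empty:
  assumes i: "i \<in> {1..d}" "p i = 1" "L i < 1"
  shows "nikolskii_indep d p \<beta> L \<P> = {}"
proof (rule ccontr)
  assume "nikolskii_indep d p \<beta> L \<P> \<noteq> {}"
  then obtain f where f: "f \<in> nikolskii_indep d p \<beta> L \<P>" by blast
  have m: "marginal d {1..d} f x = f x" if "x \<in> space (leb {1..d})" for x
  proof -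
    have "merge {1..d} {} (x, \<lambda>k. undefined) = x"
      using that by (auto simp: merge_def space_PiM PiE_def extensional_def fun_eq_iff)
    then show ?thesis
      by (simp add: marginal_def PiM_empty lebesgue_integral_count_space_finite)
  qed
  have dens: "\<forall>x\<in>space (leb {1..d}). 0 \<le> f x" "(\<integral>\<^sup>+ x. ennreal (f x) \<partial>leb {1..d}) = 1"
    using f by (auto simp: nikolskii_indep_def prob_densities_def)
  have ne: "{1..d} \<noteq> {}" using i by auto
  have "marginal d {1..d} f \<in> nikolskii {1..d} p \<beta> L"
    using f ne unfolding nikolskii_indep_def by blast
  then have "Lp_norm (leb {1..d}) (p i) (pderiv_i i 0 (marginal d {1..d} f)) \<le> ennreal (L i)"
    using i(1) unfolding nikolskii_def by blast
  moreover have "(\<integral>\<^sup>+ x. ennreal \<bar>marginal d {1..d} f x\<bar> \<partial>leb {1..d}) = (\<integral>\<^sup>+ x. ennreal (f x) \<partial>leb {1..d})"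
    by (intro nn_integral_cong) (use m dens(1) in simp)
  ultimately have "1 \<le> ennreal (L i)"
    using dens(2) i(2) by (simp add: Lp_norm_def epowr_def pderiv_i_def)
  moreover have "ennreal (L i) < 1" using i(3) by (simp add: ennreal_less_one_iff)
  ultimately show False by (simp add: not_le[symmetric])
qed

section \<open>Minimax risk and rates\<close>

definition sample_law :: "nat \<Rightarrow> nat \<Rightarrow> ((nat \<Rightarrow> real) \<Rightarrow> real) \<Rightarrow> (nat \<Rightarrow> nat \<Rightarrow> real) measure" where
  "sample_law d n f = PiM {1..n} (\<lambda>_. density (leb {1..d}) (\<lambda>x. ennreal (f x)))"

definition estimators :: "nat \<Rightarrow> nat \<Rightarrow> ((nat \<Rightarrow> nat \<Rightarrow> real) \<Rightarrow> real) set" where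
  "estimators d n = borel_measurable (PiM {1..n} (\<lambda>_. leb {1..d}))"

definition max_risk ::
  "nat \<Rightarrow> nat \<Rightarrow> real \<Rightarrow> (nat \<Rightarrow> real) \<Rightarrow> ((nat \<Rightarrow> nat \<Rightarrow> real) \<Rightarrow> real)
    \<Rightarrow> ((nat \<Rightarrow> real) \<Rightarrow> real) set \<Rightarrow> ennreal" where
  "max_risk d n q x0 T \<Sigma> =
     (SUP f\<in>\<Sigma>. epowr (\<integral>\<^sup>+ X. ennreal (\<bar>T X - f x0\<bar> powr q) \<partial>sample_law d n f) (1 / q))"

text \<open>In \<^typ>\<open>ennreal\<close>, \<open>1 / \<infinity> = 0\<close>, so indices with \<open>p i = \<infinity>\<close> contribute nothing to the first sum.\<close>

definition rate_gamma :: "(nat \<Rightarrow> real) \<Rightarrow> (nat \<Rightarrow> ennreal) \<Rightarrow> nat set \<Rightarrow> real" where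
  "rate_gamma \<beta> p I =
     (1 - (\<Sum>i\<in>I. enn2real (1 / (ennreal (\<beta> i) * p i)))) / (\<Sum>i\<in>I. 1 / \<beta> i)"

definition rate_r :: "(nat \<Rightarrow> real) \<Rightarrow> (nat \<Rightarrow> ennreal) \<Rightarrow> nat set set \<Rightarrow> real" where
  "rate_r \<beta> p \<P> = (INF I\<in>\<P>. rate_gamma \<beta> p I)"

definition rate_phi :: "nat \<Rightarrow> (nat \<Rightarrow> real) \<Rightarrow> (nat \<Rightarrow> ennreal) \<Rightarrow> nat set set \<Rightarrow> real" where
  "rate_phi n \<beta> p \<P> = (1 / real n) powr (rate_r \<beta> p \<P> / (2 * rate_r \<beta> p \<P> + 1))"

definition rate_rho :: "nat \<Rightarrow> (nat \<Rightarrow> real) \<Rightarrow> (nat \<Rightarrow> ennreal) \<Rightarrow> nat set set \<Rightarrow> real" where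
  "rate_rho n \<beta> p \<P> = (if rate_r \<beta> p \<P> \<le> 0 then 1 else rate_phi n \<beta> p \<P>)"

end

theory Submission
  imports Defs
begin

text \<open>
  Le Cam's two-point method.  Let \<open>I\<close> be a block minimising \<open>\<gamma>\<^sub>I\<close>.  The first hypothesis is a
  product of Gaussian densities centred at \<open>x\<^sub>0\<close> whose common scale \<open>\<sigma>\<close> is so large that all
  the norms in the definition of the class are small, except the \<open>L\<^sup>1\<close> norm of the
  density itself.  The second one adds
  \<open>M \<Prod>\<^sub>j\<^sub>\<in>\<^sub>I \<psi>((x\<^sub>j - x\<^sub>0\<^sub>j) / h\<^sub>j)\<close> to the marginal on \<open>I\<close>, where \<open>\<psi> = \<phi>''\<close> is the second
  derivative of the standard normal density.  Since \<open>\<psi>\<close> has integral \<open>0\<close>, the marginals on sets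
  not containing \<open>I\<close> do not change.  Write \<open>H = \<Prod>\<^sub>j\<^sub>\<in>\<^sub>I h\<^sub>j\<close>.  The perturbed density
  stays in the class if \<open>M H powr (1 / p\<^sub>i) \<le> \<kappa> h\<^sub>i powr \<beta>\<^sub>i\<close> on \<open>I\<close> and \<open>M \<le> \<kappa>\<close>, the two values at \<open>x\<^sub>0\<close> differ
  by a multiple of \<open>M\<close>, and the chi-square distance is of order \<open>M\<^sup>2 H\<close>.  If \<open>r > 0\<close>, equality in
  the first constraint gives \<open>H = (M / \<kappa>) powr (1 / r)\<close>, and \<open>n M\<^sup>2 H \<approx> 1\<close> gives the rate.  If \<open>r \<le> 0\<close>,
  the constraints allow a fixed \<open>M\<close> with \<open>H\<close> arbitrarily small.
\<close>

section \<open>Polynomials times the Gaussian density\<close>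

definition gauss_poly :: "real poly \<Rightarrow> real \<Rightarrow> real" where
  "gauss_poly P u = poly P u * std_normal_density u"

text \<open>As \<open>std_normal_density\<close> has derivative \<open>- u\<close> times itself,
  this is differentiation transported to the polynomial factor. Started at 1 it produces the Hermite
  polynomials up to sign.\<close>

definition gauss_step :: "real poly \<Rightarrow> real poly" where
  "gauss_step P = pderiv P - pCons 0 P"

text \<open>The exponent 1/8 is what remains of the Gaussian 1/2 after a polynomial factor and a
  shift of the argument by at most 1 have been paid for. It still decays at least as fast as a
  Gaussian of any scale that is 2 or more.\<close>

definition env :: "real \<Rightarrow> real" where
  "env u = exp (- (u\<^sup>2 / 8))"

lemma env_pos [simp]: "0 < env u" and env_le_1: "env u \<le> 1"
  by (auto simp: env_def)

lemma env_nonneg [simp]: "0 \<le> env u"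
  by (simp add: less_imp_le)

lemma measurable_env [measurable]: "env \<in> borel_measurable borel"
  unfolding env_def by measurable

lemma measurable_gauss_poly [measurable]: "gauss_poly P \<in> borel_measurable borel"
proof -
  have "continuous_on UNIV (poly P)" by (intro continuous_intros)
  then have [measurable]: "poly P \<in> borel_measurable borel"
    by (rule borel_measurable_continuous_onI)
  show ?thesis unfolding gauss_poly_def by measurable
qed

lemma has_integral_env:
  assumes "0 < s"
  shows "has_bochner_integral lborel (\<lambda>x. env ((x - c) / s)) (sqrt (8 * pi) * s)"
proof -
  have eq: "env ((x - c) / s) = sqrt (8 * pi) * s * normal_density c (2 * s) x" for x
  proof -
    have "sqrt (2 * pi * (2 * s)\<^sup>2) = sqrt (8 * pi) * s"
      using assms by (simp add: power_mult_distrib real_sqrt_mult)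
    moreover have "sqrt (8 * pi) * s \<noteq> 0" using assms by simp
    ultimately show ?thesis
      by (simp add: env_def normal_density_def power_divide power_mult_distrib)
  qed
  have "has_bochner_integral lborel (\<lambda>x. sqrt (8 * pi) * s * normal_density c (2 * s) x)
      (sqrt (8 * pi) * s * 1)"
    using assms by (intro has_bochner_integral_mult_right)
      (simp add: has_bochner_integral_iff)
  then show ?thesis by (simp add: eq)
qed

lemma gauss_poly_has_deriv: "(gauss_poly P has_real_derivative gauss_poly (gauss_step P) u) (at u)"
proof -
  define K where "K = 1 / sqrt (2 * pi)"
  have "((\<lambda>u. poly P u * (K * exp (- u\<^sup>2 / 2))) has_real_derivative
      poly (pderiv P - pCons 0 P) u * (K * exp (- u\<^sup>2 / 2))) (at u)"
    by (auto intro!: derivative_eq_intros simp: algebra_simps power2_eq_square)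
  then show ?thesis
    by (simp add: gauss_poly_def[abs_def] gauss_step_def std_normal_density_def K_def)
qed

lemma gauss_poly_affine_has_deriv:
  assumes "s \<noteq> 0"
  shows "((\<lambda>x. w * gauss_poly P ((x - c) / s)) has_real_derivative w / s * gauss_poly (gauss_step P) ((x - c) / s)) (at x)"
  using assms by (auto intro!: derivative_eq_intros DERIV_chain2[OF gauss_poly_has_deriv])

section \<open>Decay and Hoelder bounds in one dimension\<close>

text \<open>Horner induction: half of the rate \<open>e\<close> absorbs the new factor
  \<open>u\<close>, the other half the polynomial of lower degree. The hypothesis is thus used at
  \<open>e / 2\<close>, so \<open>e\<close> must be arbitrary.\<close>

lemma poly_le_exp:
  fixes P :: "real poly"
  assumes "0 < e"
  shows "\<exists>D\<ge>0. \<forall>u. \<bar>poly P u\<bar> \<le> D * exp (e * u\<^sup>2)"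
  using assms
proof (induction P arbitrary: e)
  case 0
  then show ?case by (auto intro!: exI[of _ 0])
next
  case (pCons a P)
  have "0 < e / 2" using pCons.prems by simp
  from pCons.IH[OF this] obtain D where D: "D \<ge> 0" "\<And>u. \<bar>poly P u\<bar> \<le> D * exp (e / 2 * u\<^sup>2)"
    by blast
  \<comment> \<open>Large enough that \<open>1 + u^2 \<le> k * (1 + e / 2 * u^2)\<close>, which
    \<open>1 + x \<le> exp x\<close> turns into the exponential bound.\<close>
  define k where "k = max 1 (2 / e)"
  have k: "1 \<le> k" "2 / e \<le> k" by (auto simp: k_def)
  have u: "\<bar>u\<bar> \<le> k * exp (e / 2 * u\<^sup>2)" for u :: real
  proof -
    have "0 \<le> (\<bar>u\<bar> - 1)\<^sup>2" by simp
    then have "\<bar>u\<bar> \<le> 1 + u\<^sup>2"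
      by (simp add: power2_eq_square algebra_simps)
    also have "\<dots> \<le> k * (1 + e / 2 * u\<^sup>2)"
    proof -
      have "1 \<le> k * (e / 2)" using k(2) pCons.prems by (simp add: field_simps)
      then have "u\<^sup>2 * 1 \<le> u\<^sup>2 * (k * (e / 2))" by (intro mult_left_mono) auto
      then show ?thesis using k(1) by (simp add: algebra_simps)
    qed
    also have "\<dots> \<le> k * exp (e / 2 * u\<^sup>2)"
      using k(1) by (intro mult_left_mono exp_ge_add_one_self) auto
    finally show ?thesis .
  qed
  have "\<bar>poly (pCons a P) u\<bar> \<le> (\<bar>a\<bar> + k * D) * exp (e * u\<^sup>2)" for u
  proof -
    have "\<bar>poly (pCons a P) u\<bar> \<le> \<bar>a\<bar> * 1 + \<bar>u\<bar> * \<bar>poly P u\<bar>"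
      by (simp add: abs_mult[symmetric])
    also have "\<dots> \<le> \<bar>a\<bar> * exp (e * u\<^sup>2) + (k * exp (e / 2 * u\<^sup>2)) * (D * exp (e / 2 * u\<^sup>2))"
      using D k u pCons.prems by (intro add_mono mult_left_mono mult_mono) auto
    also have "\<dots> = (\<bar>a\<bar> + k * D) * exp (e * u\<^sup>2)"
      by (simp add: algebra_simps flip: exp_add)
    finally show ?thesis .
  qed
  moreover have "0 \<le> \<bar>a\<bar> + k * D" using D k by auto
  ultimately show ?case by blast
qed

text \<open>Half of the Gaussian exponent 1/2 is spent on the polynomial.\<close>

lemma gauss_poly_le_exp: "\<exists>D\<ge>0. \<forall>u. \<bar>gauss_poly P u\<bar> \<le> D * exp (- (u\<^sup>2 / 4))"
proof -
  obtain D where D: "D \<ge> 0" "\<And>u. \<bar>poly P u\<bar> \<le> D * exp (1 / 4 * u\<^sup>2)"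
    using poly_le_exp[of "1/4" P] by auto
  have sq: "1 / sqrt (2 * pi) \<le> 1"
  proof -
    have "1 \<le> 2 * pi" using pi_gt3 by linarith
    then show ?thesis by simp
  qed
  have "\<bar>gauss_poly P u\<bar> \<le> D * exp (- (u\<^sup>2 / 4))" for u
  proof -
    have "\<bar>gauss_poly P u\<bar> = \<bar>poly P u\<bar> * (1 / sqrt (2 * pi) * exp (- u\<^sup>2 / 2))"
      by (simp add: gauss_poly_def std_normal_density_def abs_mult)
    also have "\<dots> \<le> (D * exp (1 / 4 * u\<^sup>2)) * (1 * exp (- u\<^sup>2 / 2))"
      using D sq by (intro mult_mono mult_right_mono) auto
    also have "\<dots> = D * exp (- (u\<^sup>2 / 4))"
      by (simp flip: exp_add)
    finally show ?thesis .
  qed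
  then show ?thesis using D(1) by blast
qed

text \<open>
  The second clause interpolates between the Lipschitz bound (\<open>b = 1\<close>, small \<open>t\<close>) and the trivial
  bound (\<open>b = 0\<close>, large \<open>t\<close>), which gives the Hoelder condition for every order at once.
\<close>

definition env_bound :: "real \<Rightarrow> real poly \<Rightarrow> bool" where
  "env_bound D P \<longleftrightarrow> (\<forall>u. \<bar>gauss_poly P u\<bar> \<le> D * env u) \<and>
     (\<forall>u t b. 0 \<le> b \<and> b \<le> 1 \<longrightarrow> \<bar>gauss_poly P (u + t) - gauss_poly P u\<bar> \<le> D * \<bar>t\<bar> powr b * (env u + env (u + t)))"

lemma env_bound_mono:
  assumes "env_bound D P" "D \<le> D'"
  shows "env_bound D' P"
  unfolding env_bound_def
proof (intro conjI allI impI)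
  fix u
  have "\<bar>gauss_poly P u\<bar> \<le> D * env u" using assms by (simp add: env_bound_def)
  also have "\<dots> \<le> D' * env u" using assms by (intro mult_right_mono) auto
  finally show "\<bar>gauss_poly P u\<bar> \<le> D' * env u" .
next
  fix u t b :: real assume "0 \<le> b \<and> b \<le> 1"
  then have "\<bar>gauss_poly P (u + t) - gauss_poly P u\<bar> \<le> D * \<bar>t\<bar> powr b * (env u + env (u + t))"
    using assms by (simp add: env_bound_def)
  also have "\<dots> \<le> D' * \<bar>t\<bar> powr b * (env u + env (u + t))"
    using assms by (intro mult_right_mono) (auto intro: add_nonneg_nonneg)
  finally show "\<bar>gauss_poly P (u + t) - gauss_poly P u\<bar> \<le> D' * \<bar>t\<bar> powr b * (env u + env (u + t))" .
qed

text \<open>For \<open>\<bar>t\<bar> \<le> 1\<close> the mean value inequality applies and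
  \<open>\<bar>t\<bar> \<le> \<bar>t\<bar> powr b\<close>; for larger \<open>t\<close> the sizes of
  the two values suffice, since then \<open>1 \<le> \<bar>t\<bar> powr b\<close>.\<close>

lemma env_bound_exists: "\<exists>D\<ge>1. env_bound D P"
proof -
  obtain D1 where D1: "D1 \<ge> 0" "\<And>u. \<bar>gauss_poly P u\<bar> \<le> D1 * exp (- (u\<^sup>2 / 4))"
    using gauss_poly_le_exp by blast
  obtain D2 where D2: "D2 \<ge> 0" "\<And>u. \<bar>gauss_poly (gauss_step P) u\<bar> \<le> D2 * exp (- (u\<^sup>2 / 4))"
    using gauss_poly_le_exp by blast
  define D where "D = 1 + D1 + D2 * exp (1/4)"
  have D: "1 \<le> D" "D1 \<le> D" "D2 * exp (1/4) \<le> D" using D1 D2 by (auto simp: D_def)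
  have b1: "\<bar>gauss_poly P u\<bar> \<le> D1 * env u" for u
  proof -
    have "\<bar>gauss_poly P u\<bar> \<le> D1 * exp (- (u\<^sup>2 / 4))" by (rule D1)
    also have "\<dots> \<le> D1 * env u" unfolding env_def using D1(1) by (intro mult_left_mono) auto
    finally show ?thesis .
  qed
  have "\<bar>gauss_poly P (u + t) - gauss_poly P u\<bar> \<le> D * \<bar>t\<bar> powr b * (env u + env (u + t))"
    if b: "0 \<le> b" "b \<le> 1" for u t b
  proof (cases "\<bar>t\<bar> \<le> 1")
    case True
    have "\<bar>gauss_poly (gauss_step P) z\<bar> \<le> D2 * exp (1/4) * env u" if "\<bar>z - u\<bar> \<le> 1" for z
    proof -
      \<comment> \<open>This is \<open>u^2 \<le> 2 * z^2 + 2 * (z - u)^2\<close>. The additive 1/4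
        becomes the factor \<open>exp (1/4)\<close> in \<open>D\<close>, and the decay rate drops
        from 1/4 to 1/8.\<close>
      have "u\<^sup>2 / 8 - 1 / 4 \<le> z\<^sup>2 / 4"
      proof -
        have "(z - u)\<^sup>2 \<le> 1" using that by (simp add: abs_square_le_1)
        moreover have "0 \<le> (2 * z - u)\<^sup>2" by simp
        ultimately show ?thesis by (simp add: power2_eq_square algebra_simps)
      qed
      then have "exp (- (z\<^sup>2 / 4)) \<le> exp (1/4) * env u"
        unfolding env_def by (simp flip: exp_add)
      then have "D2 * exp (- (z\<^sup>2 / 4)) \<le> D2 * (exp (1/4) * env u)"
        using D2(1) by (intro mult_left_mono)
      then show ?thesis using D2(2)[of z] by simp
    qed
    then have "norm (gauss_poly P (u + t) - gauss_poly P u) \<le> (D2 * exp (1/4) * env u) * norm (u + t - u)"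
      using True
      by (intro field_differentiable_bound[where S = "cball u 1" and f = "gauss_poly P" and f' = "gauss_poly (gauss_step P)"]
            has_field_derivative_at_within[OF gauss_poly_has_deriv])
         (auto simp: dist_real_def abs_minus_commute)
    then have "\<bar>gauss_poly P (u + t) - gauss_poly P u\<bar> \<le> (D2 * exp (1/4) * env u) * \<bar>t\<bar>" by simp
    also have "\<dots> \<le> (D * (env u + env (u + t))) * \<bar>t\<bar> powr b"
    proof (intro mult_mono)
      show "D2 * exp (1 / 4) \<le> D" by fact
      show "env u \<le> env u + env (u + t)" by simp
      have "\<bar>t\<bar> powr 1 \<le> \<bar>t\<bar> powr b" if "t \<noteq> 0"
        using True b that by (intro powr_mono') auto
      then show "\<bar>t\<bar> \<le> \<bar>t\<bar> powr b" by (cases "t = 0") auto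
    qed (use D in \<open>auto intro!: mult_nonneg_nonneg add_nonneg_nonneg\<close>)
    finally show ?thesis by (simp add: mult_ac)
  next
    case False
    have "\<bar>gauss_poly P (u + t) - gauss_poly P u\<bar> \<le> D1 * (env u + env (u + t)) * 1"
      using b1[of u] b1[of "u + t"] by (simp add: algebra_simps)
    also have "\<dots> \<le> D * (env u + env (u + t)) * \<bar>t\<bar> powr b"
      using D False b by (intro mult_mono ge_one_powr_ge_zero) (auto intro!: mult_nonneg_nonneg add_nonneg_nonneg)
    finally show ?thesis by (simp add: mult_ac)
  qed
  moreover have "\<bar>gauss_poly P u\<bar> \<le> D * env u" for u
    using b1[of u] D by (meson env_nonneg mult_right_mono order_trans)
  ultimately show ?thesis using D(1) unfolding env_bound_def by blast
qed

lemma env_bound_finite: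
  assumes "finite S"
  shows "\<exists>D\<ge>1. \<forall>P\<in>S. env_bound D P"
  using assms
proof induction
  case empty
  then show ?case by auto
next
  case (insert P S)
  then obtain D where "D \<ge> 1" "\<forall>P\<in>S. env_bound D P" by blast
  moreover obtain D' where "D' \<ge> 1" "env_bound D' P" using env_bound_exists by blast
  ultimately show ?case
    by (intro exI[of _ "max D D'"]) (auto intro: env_bound_mono)
qed

section \<open>The perturbation profile and its integral\<close>

text \<open>The Hermite polynomial of \<open>\<phi>''\<close>: the perturbation profile, with integral \<open>0\<close> and value \<open>- \<phi> 0\<close> at \<open>0\<close>.\<close>

definition mexican :: "real poly" where
  "mexican = [:-1, 0, 1:]"

lemma has_integral_gauss_poly_1: "has_bochner_integral lborel (gauss_poly 1) 1"
  unfolding gauss_poly_def by (simp add: has_bochner_integral_iff)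

text \<open>The integral is the second moment of the standard normal law minus its zeroth moment,
  and both are 1.\<close>

lemma has_integral_gauss_poly_mexican: "has_bochner_integral lborel (gauss_poly mexican) 0"
proof -
  have "has_bochner_integral lborel
      (\<lambda>x. std_normal_density x * x ^ (2 * 1) - std_normal_density x * x ^ (2 * 0))
      (fact (2 * 1) / (2 ^ 1 * fact 1) - fact (2 * 0) / (2 ^ 0 * fact 0))"
    by (intro has_bochner_integral_diff std_normal_moment_even)
  then show ?thesis
    by (rule has_bochner_integral_cong[THEN iffD1, rotated -1])
      (auto simp: gauss_poly_def mexican_def power2_eq_square algebra_simps)
qed

lemma has_integral_gauss_poly_affine:
  assumes "has_bochner_integral lborel (gauss_poly P) v" "0 < s"
  shows "has_bochner_integral lborel (\<lambda>x. w * gauss_poly P ((x - c) / s)) (w * s * v)"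
proof -
  have "has_bochner_integral lborel (\<lambda>x. gauss_poly P (- c / s + (1 / s) * x)) (v /\<^sub>R \<bar>1 / s\<bar>)"
    using assms by (intro lborel_has_bochner_integral_real_affine_iff[THEN iffD1, OF _ ]) auto
  then have "has_bochner_integral lborel (\<lambda>x. w * gauss_poly P (- c / s + (1 / s) * x)) (w * (v /\<^sub>R \<bar>1 / s\<bar>))"
    by (intro has_bochner_integral_mult_right)
  moreover have "(\<lambda>x. w * gauss_poly P (- c / s + (1 / s) * x)) = (\<lambda>x. w * gauss_poly P ((x - c) / s))"
    by (simp add: diff_divide_distrib algebra_simps)
  ultimately show ?thesis using assms(2) by (simp add: algebra_simps)
qed

section \<open>Norms of products of one-dimensional functions\<close>

lemma epowr_le:
  assumes "0 \<le> s" "w \<le> ennreal v" "0 \<le> v"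
  shows "epowr w s \<le> ennreal (v powr s)"
proof (cases w)
  case (real r)
  then have "r \<le> v" using assms by simp
  then show ?thesis using real assms by (auto simp: epowr_def intro!: ennreal_leI powr_mono2)
qed (use assms in \<open>auto simp: epowr_def top_unique\<close>)

lemma le_of_epowr_le:
  assumes "0 < s" "epowr w (1 / s) \<le> ennreal v" "0 \<le> v"
  shows "w \<le> ennreal (v powr s)"
proof (cases w)
  case (real r)
  then have "r powr (1 / s) \<le> v" using assms by (simp add: epowr_def)
  then have "(r powr (1 / s)) powr s \<le> v powr s" using assms by (intro powr_mono2) auto
  then show ?thesis using real assms by (auto simp: powr_powr intro!: ennreal_leI)
qed (use assms in \<open>auto simp: epowr_def top_unique\<close>)

lemma exponent_cases:
  fixes p :: ennreal
  assumes "1 \<le> p"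
  obtains "p = \<infinity>" | r where "p = ennreal r" "1 \<le> r" "enn2real p = r" "p \<noteq> \<infinity>" "enn2real (1 / p) = 1 / r"
proof (cases p)
  case (real r)
  then have "1 \<le> r" using assms by (simp flip: ennreal_1)
  moreover have "1 / p = ennreal (1 / r)"
    using real \<open>1 \<le> r\<close> by (simp flip: ennreal_1 add: divide_ennreal)
  ultimately show ?thesis using real that(2)[of r] by simp
qed (use that in auto)

text \<open>The product of envelopes takes values in [0, 1], so its \<open>r\<close>-th power is at
  most itself. One Gaussian integral, computed by Tonelli, therefore serves every finite
  exponent.\<close>

lemma Lp_norm_dominated:
  assumes fin: "finite J" and s: "\<And>j. j \<in> J \<Longrightarrow> 0 < s j" and p: "1 \<le> p" and V: "0 \<le> V"
    and [measurable]: "F \<in> borel_measurable (leb J)"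
    and dom: "\<And>x. x \<in> space (leb J) \<Longrightarrow> \<bar>F x\<bar> \<le> V * (\<Prod>j\<in>J. env ((x j - c j) / s j))"
  shows "Lp_norm (leb J) p F \<le> ennreal (V * (\<Prod>j\<in>J. sqrt (8 * pi) * s j) powr enn2real (1 / p))"
  using p
proof (cases rule: exponent_cases)
  case 1
  \<comment> \<open>For \<open>p = \<infinity>\<close> the exponent in the claim is 0, and
    \<open>powr\<close> has value 1 at exponent 0 only if the base is nonzero.\<close>
  have "(\<Prod>j\<in>J. sqrt (8 * pi) * s j) > 0" using s by (intro prod_pos) auto
  moreover have "esssup (leb J) (\<lambda>x. ennreal \<bar>F x\<bar>) \<le> ennreal V"
  proof (rule esssup_I)
    show "AE x in leb J. ennreal \<bar>F x\<bar> \<le> ennreal V"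
    proof (rule AE_I2)
      fix x assume "x \<in> space (leb J)"
      then have "\<bar>F x\<bar> \<le> V * (\<Prod>j\<in>J. env ((x j - c j) / s j))" by (rule dom)
      also have "\<dots> \<le> V * 1" using V by (intro mult_left_mono prod_le_1) (auto simp: env_le_1)
      finally show "ennreal \<bar>F x\<bar> \<le> ennreal V" by (simp add: ennreal_leI)
    qed
  qed measurable
  ultimately show ?thesis using 1 by (simp add: Lp_norm_def)
next
  case (2 r)
  interpret product_sigma_finite "\<lambda>_::nat. lborel :: real measure" by standard
  let ?I = "\<Prod>j\<in>J. sqrt (8 * pi) * s j"
  have I0: "0 \<le> ?I" using s by (intro prod_nonneg) (auto simp: less_imp_le)
  have "(\<integral>\<^sup>+ x. ennreal (\<bar>F x\<bar> powr r) \<partial>leb J) \<le>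
      (\<integral>\<^sup>+ x. ennreal (V powr r) * (\<Prod>j\<in>J. ennreal (env ((x j - c j) / s j))) \<partial>leb J)"
  proof (intro nn_integral_mono)
    fix x assume x: "x \<in> space (leb J)"
    let ?E = "\<Prod>j\<in>J. env ((x j - c j) / s j)"
    have E: "0 \<le> ?E" "?E \<le> 1" by (auto intro!: prod_nonneg prod_le_1 simp: env_le_1)
    have "\<bar>F x\<bar> powr r \<le> (V * ?E) powr r"
      using dom[OF x] 2 by (intro powr_mono2) auto
    also have "\<dots> = V powr r * ?E powr r" using V E by (simp add: powr_mult)
    also have "\<dots> \<le> V powr r * ?E powr 1"
      using 2 E by (intro mult_left_mono powr_mono') auto
    also have "\<dots> = V powr r * ?E" using E by simp
    finally show "ennreal (\<bar>F x\<bar> powr r) \<le> ennreal (V powr r) * (\<Prod>j\<in>J. ennreal (env ((x j - c j) / s j)))"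
      using E by (simp add: prod_ennreal ennreal_leI flip: ennreal_mult)
  qed
  also have "\<dots> = ennreal (V powr r) * (\<integral>\<^sup>+ x. (\<Prod>j\<in>J. ennreal (env ((x j - c j) / s j))) \<partial>leb J)"
    by (rule nn_integral_cmult) measurable
  also have "\<dots> = ennreal (V powr r) * (\<Prod>j\<in>J. \<integral>\<^sup>+ x. ennreal (env ((x - c j) / s j)) \<partial>lborel)"
    using fin by (subst product_nn_integral_prod) auto
  also have "(\<Prod>j\<in>J. \<integral>\<^sup>+ x. ennreal (env ((x - c j) / s j)) \<partial>lborel) = (\<Prod>j\<in>J. ennreal (sqrt (8 * pi) * s j))"
  proof (intro prod.cong refl)
    fix j assume "j \<in> J"
    then have "has_bochner_integral lborel (\<lambda>x. env ((x - c j) / s j)) (sqrt (8 * pi) * s j)"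
      by (intro has_integral_env s)
    then show "(\<integral>\<^sup>+ x. ennreal (env ((x - c j) / s j)) \<partial>lborel) = ennreal (sqrt (8 * pi) * s j)"
      by (subst nn_integral_eq_integral) (auto simp: has_bochner_integral_iff)
  qed
  also have "ennreal (V powr r) * (\<Prod>j\<in>J. ennreal (sqrt (8 * pi) * s j)) = ennreal (V powr r * ?I)"
    using s by (subst prod_ennreal) (auto simp: less_imp_le ennreal_mult prod_nonneg)
  finally have "epowr (\<integral>\<^sup>+ x. ennreal (\<bar>F x\<bar> powr r) \<partial>leb J) (1 / r) \<le> ennreal ((V powr r * ?I) powr (1 / r))"
    using 2 I0 by (intro epowr_le) auto
  also have "(V powr r * ?I) powr (1 / r) = V * ?I powr (1 / r)"
    using 2 V I0 by (simp add: powr_mult powr_powr)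
  finally show ?thesis using 2 by (simp add: Lp_norm_def)
qed

text \<open>The constant \<open>4\<close> makes Minkowski's inequality unnecessary.\<close>

lemma Lp_norm_add_le:
  assumes p: "1 \<le> p" and uv: "0 \<le> u" "0 \<le> v"
    and [measurable]: "F \<in> borel_measurable M" "A \<in> borel_measurable M" "B \<in> borel_measurable M"
    and le: "\<And>x. x \<in> space M \<Longrightarrow> \<bar>F x\<bar> \<le> \<bar>A x\<bar> + \<bar>B x\<bar>"
    and A: "Lp_norm M p A \<le> ennreal u" and B: "Lp_norm M p B \<le> ennreal v"
  shows "Lp_norm M p F \<le> ennreal (4 * (u + v))"
  using p
proof (cases rule: exponent_cases)
  case 1
  have a: "AE x in M. ennreal \<bar>A x\<bar> \<le> ennreal u"
    using esssup_AE[of "\<lambda>x. ennreal \<bar>A x\<bar>" M] A 1 by (auto simp: Lp_norm_def)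
  have b: "AE x in M. ennreal \<bar>B x\<bar> \<le> ennreal v"
    using esssup_AE[of "\<lambda>x. ennreal \<bar>B x\<bar>" M] B 1 by (auto simp: Lp_norm_def)
  have "esssup M (\<lambda>x. ennreal \<bar>F x\<bar>) \<le> ennreal (4 * (u + v))"
  proof (rule esssup_I)
    show "AE x in M. ennreal \<bar>F x\<bar> \<le> ennreal (4 * (u + v))"
      using a b AE_space
    proof eventually_elim
      case (elim x)
      then show ?case using le[of x] uv by (auto intro!: ennreal_leI simp del: ennreal_plus)
    qed
  qed measurable
  then show ?thesis using 1 by (simp add: Lp_norm_def)
next
  case (2 r)
  have a: "(\<integral>\<^sup>+ x. ennreal (\<bar>A x\<bar> powr r) \<partial>M) \<le> ennreal (u powr r)"
    using A 2 uv by (intro le_of_epowr_le) (auto simp: Lp_norm_def)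
  have b: "(\<integral>\<^sup>+ x. ennreal (\<bar>B x\<bar> powr r) \<partial>M) \<le> ennreal (v powr r)"
    using B 2 uv by (intro le_of_epowr_le) (auto simp: Lp_norm_def)
  have "(\<integral>\<^sup>+ x. ennreal (\<bar>F x\<bar> powr r) \<partial>M) \<le>
      (\<integral>\<^sup>+ x. ennreal (2 powr r) * (ennreal (\<bar>A x\<bar> powr r) + ennreal (\<bar>B x\<bar> powr r)) \<partial>M)"
  proof (intro nn_integral_mono)
    fix x assume x: "x \<in> space M"
    \<comment> \<open>Replacing the sum by twice the maximum costs \<open>2 powr r\<close>; adding
      the two integrals costs a second factor 2, whence the 4.\<close>
    define m where "m = max \<bar>A x\<bar> \<bar>B x\<bar>"
    have "\<bar>F x\<bar> powr r \<le> (2 * m) powr r"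
      using le[OF x] 2 unfolding m_def by (intro powr_mono2) auto
    also have "\<dots> = 2 powr r * m powr r" by (simp add: m_def powr_mult)
    also have "\<dots> \<le> 2 powr r * (\<bar>A x\<bar> powr r + \<bar>B x\<bar> powr r)"
      by (intro mult_left_mono) (auto simp: m_def max_def)
    finally show "ennreal (\<bar>F x\<bar> powr r) \<le>
        ennreal (2 powr r) * (ennreal (\<bar>A x\<bar> powr r) + ennreal (\<bar>B x\<bar> powr r))"
      by (simp add: ennreal_leI flip: ennreal_mult ennreal_plus)
  qed
  also have "\<dots> = ennreal (2 powr r) *
      ((\<integral>\<^sup>+ x. ennreal (\<bar>A x\<bar> powr r) \<partial>M) + (\<integral>\<^sup>+ x. ennreal (\<bar>B x\<bar> powr r) \<partial>M))"
    by (simp add: nn_integral_cmult nn_integral_add)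
  also have "\<dots> \<le> ennreal (2 powr r) * (ennreal (u powr r) + ennreal (v powr r))"
    using a b by (intro mult_left_mono add_mono) auto
  also have "\<dots> \<le> ennreal ((4 * (u + v)) powr r)"
  proof -
    have "2 powr r * (u powr r + v powr r) \<le> 2 powr r * ((u + v) powr r + (u + v) powr r)"
      using uv 2 by (intro mult_left_mono add_mono powr_mono2) auto
    also have "\<dots> = 2 powr r * (2 powr 1 * (u + v) powr r)" by simp
    also have "\<dots> \<le> 2 powr r * (2 powr r * (u + v) powr r)"
      using 2 by (intro mult_left_mono mult_right_mono powr_mono) auto
    also have "\<dots> = (2 * (2 * (u + v))) powr r" by (simp only: powr_mult mult.assoc)
    also have "2 * (2 * (u + v)) = 4 * (u + v)" by simp
    finally show ?thesis by (simp add: ennreal_leI flip: ennreal_mult ennreal_plus)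
  qed
  finally have "epowr (\<integral>\<^sup>+ x. ennreal (\<bar>F x\<bar> powr r) \<partial>M) (1 / r) \<le> ennreal (((4 * (u + v)) powr r) powr (1 / r))"
    using 2 by (intro epowr_le) auto
  then show ?thesis using 2 uv by (simp add: Lp_norm_def powr_powr)
qed

section \<open>Products of one-dimensional factors and their partial derivatives\<close>

text \<open>Weight, polynomial, centre and scale depend on the coordinate, so that a partial
  derivative stays in the family after an update at one coordinate.\<close>

definition gauss_prod :: "nat set \<Rightarrow> (nat \<Rightarrow> real) \<Rightarrow> (nat \<Rightarrow> real poly) \<Rightarrow> (nat \<Rightarrow> real) \<Rightarrow> (nat \<Rightarrow> real)
    \<Rightarrow> (nat \<Rightarrow> real) \<Rightarrow> real" where
  "gauss_prod J w P c s x = (\<Prod>j\<in>J. w j * gauss_poly (P j) ((x j - c j) / s j))"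

lemma measurable_gauss_prod [measurable]: "gauss_prod J w P c s \<in> borel_measurable (leb J)"
  unfolding gauss_prod_def by measurable

lemma measurable_shift:
  assumes "i \<in> J"
  shows "(\<lambda>x. x(i := x i + t)) \<in> measurable (leb J) (leb J)"
  using assms by (intro measurable_fun_upd[where J = J]) auto

lemma gauss_prod_fun_upd:
  assumes "finite J" "i \<in> J"
  shows "gauss_prod J w P c s (x(i := t)) = gauss_prod (J - {i}) w P c s x * (w i * gauss_poly (P i) ((t - c i) / s i))"
proof -
  have "gauss_prod (J - {i}) w P c s (x(i := t)) = gauss_prod (J - {i}) w P c s x"
    unfolding gauss_prod_def by (intro prod.cong) auto
  then show ?thesis
    using assms unfolding gauss_prod_def by (simp add: prod.remove[of J i] mult.commute)
qed

text \<open>Two terms are carried along because the perturbed density is a sum of two products. The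
  claim is an equality of functions, since the next \<open>deriv\<close> needs more than the value
  at a single point.\<close>

lemma deriv_iter_gauss_poly:
  assumes "s \<noteq> 0" "s' \<noteq> 0"
  shows "(deriv ^^ k) (\<lambda>u. a * gauss_poly P ((u - c) / s) + a' * gauss_poly P' ((u - c) / s')) =
    (\<lambda>u. a / s ^ k * gauss_poly ((gauss_step ^^ k) P) ((u - c) / s) + a' / s' ^ k * gauss_poly ((gauss_step ^^ k) P') ((u - c) / s'))"
proof (induction k)
  case (Suc k)
  show ?case
    unfolding funpow.simps(2) o_apply Suc.IH
  proof (rule ext, rule DERIV_imp_deriv)
    fix u
    show "((\<lambda>u. a / s ^ k * gauss_poly ((gauss_step ^^ k) P) ((u - c) / s) +
        a' / s' ^ k * gauss_poly ((gauss_step ^^ k) P') ((u - c) / s')) has_real_derivative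
      a / s ^ Suc k * gauss_poly (gauss_step ((gauss_step ^^ k) P)) ((u - c) / s) +
        a' / s' ^ Suc k * gauss_poly (gauss_step ((gauss_step ^^ k) P')) ((u - c) / s')) (at u)"
      using DERIV_add[OF gauss_poly_affine_has_deriv[OF assms(1), of "a / s ^ k" _ c u]
          gauss_poly_affine_has_deriv[OF assms(2), of "a' / s' ^ k" _ c u]]
      by (simp add: mult_ac)
  qed
qed simp

lemma mix_fun_upd:
  assumes "finite J" "i \<in> J"
  shows "(\<lambda>u. v * gauss_prod J w P c s (x(i := u)) + v' * gauss_prod J w' P' c s' (x(i := u))) =
    (\<lambda>u. (v * gauss_prod (J - {i}) w P c s x * w i) * gauss_poly (P i) ((u - c i) / s i) +
         (v' * gauss_prod (J - {i}) w' P' c s' x * w' i) * gauss_poly (P' i) ((u - c i) / s' i))"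
  by (simp add: gauss_prod_fun_upd[OF assms] mult_ac)

text \<open>By \<open>mix_fun_upd\<close> the other coordinates act as constants, so only weight and
  polynomial at \<open>i\<close> change. Norm bounds for products then apply to derivatives as
  well.\<close>

lemma pderiv_mix:
  assumes "finite J" "i \<in> J" "s i \<noteq> 0" "s' i \<noteq> 0"
  shows "pderiv_i i k (\<lambda>x. v * gauss_prod J w P c s x + v' * gauss_prod J w' P' c s' x) =
    (\<lambda>x. v * gauss_prod J (w(i := w i / s i ^ k)) (P(i := (gauss_step ^^ k) (P i))) c s x +
         v' * gauss_prod J (w'(i := w' i / s' i ^ k)) (P'(i := (gauss_step ^^ k) (P' i))) c s' x)"
proof
  fix x
  have *: "gauss_prod J (w(i := w i / s i ^ k)) (P(i := (gauss_step ^^ k) (P i))) c s x =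
      gauss_prod (J - {i}) w P c s x * (w i / s i ^ k * gauss_poly ((gauss_step ^^ k) (P i)) ((x i - c i) / s i))" for w P s
  proof -
    have "gauss_prod (J - {i}) (w(i := w i / s i ^ k)) (P(i := (gauss_step ^^ k) (P i))) c s x = gauss_prod (J - {i}) w P c s x"
      unfolding gauss_prod_def by (intro prod.cong) auto
    then show ?thesis
      using gauss_prod_fun_upd[OF assms(1,2), of "w(i := w i / s i ^ k)" "P(i := (gauss_step ^^ k) (P i))" c s x "x i"]
      by simp
  qed
  show "pderiv_i i k (\<lambda>x. v * gauss_prod J w P c s x + v' * gauss_prod J w' P' c s' x) x =
      v * gauss_prod J (w(i := w i / s i ^ k)) (P(i := (gauss_step ^^ k) (P i))) c s x +
      v' * gauss_prod J (w'(i := w' i / s' i ^ k)) (P'(i := (gauss_step ^^ k) (P' i))) c s' x"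
    unfolding pderiv_i_def mix_fun_upd[OF assms(1,2)] deriv_iter_gauss_poly[OF assms(3,4)] *
    by (simp add: mult_ac)
qed

lemma differentiable_mix:
  assumes "finite J" "i \<in> J" "s i \<noteq> 0" "s' i \<noteq> 0"
  shows "(deriv ^^ k) (\<lambda>u. v * gauss_prod J w P c s (x(i := u)) + v' * gauss_prod J w' P' c s' (x(i := u)))
    field_differentiable at t"
  unfolding mix_fun_upd[OF assms(1,2)] deriv_iter_gauss_poly[OF assms(3,4)] field_differentiable_def
  by (rule exI, rule DERIV_add; rule gauss_poly_affine_has_deriv; fact)

section \<open>Norm bounds for products and their increments\<close>

text \<open>In coordinate \<open>j\<close> the amplitude is at most \<open>w j * D\<close>, and
  \<open>sqrt (8 * pi) * s j\<close> is the integral of the envelope, which enters the norm with the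
  reciprocal of \<open>p\<close> as exponent.\<close>

definition gauss_prod_bound :: "real \<Rightarrow> nat set \<Rightarrow> (nat \<Rightarrow> real) \<Rightarrow> (nat \<Rightarrow> real) \<Rightarrow> ennreal \<Rightarrow> real" where
  "gauss_prod_bound D J w s p = (\<Prod>j\<in>J. w j * D * (sqrt (8 * pi) * s j) powr enn2real (1 / p))"

lemma gauss_prod_bound_nonneg:
  assumes "\<And>j. j \<in> J \<Longrightarrow> 0 \<le> w j" "0 \<le> D"
  shows "0 \<le> gauss_prod_bound D J w s p"
  unfolding gauss_prod_bound_def using assms by (intro prod_nonneg) auto

lemma gauss_prod_bound_fun_upd:
  assumes "finite J" "i \<in> J"
  shows "gauss_prod_bound D J (w(i := w i / z)) s p = gauss_prod_bound D J w s p / z"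
proof -
  have "(\<Prod>j\<in>J - {i}. (w(i := w i / z)) j * D * (sqrt (8 * pi) * s j) powr enn2real (1 / p)) =
      (\<Prod>j\<in>J - {i}. w j * D * (sqrt (8 * pi) * s j) powr enn2real (1 / p))"
    by (intro prod.cong) auto
  then show ?thesis
    using assms by (simp add: gauss_prod_bound_def prod.remove[of J i])
qed

lemma Lp_norm_env_prod:
  assumes "finite J" "\<And>j. j \<in> J \<Longrightarrow> 0 < s j" "1 \<le> p" "0 \<le> V"
    and w: "\<And>j. j \<in> J \<Longrightarrow> 0 \<le> w j" "0 \<le> D"
    and "F \<in> borel_measurable (leb J)"
    and dom: "\<And>x. x \<in> space (leb J) \<Longrightarrow> \<bar>F x\<bar> \<le> V * (\<Prod>j\<in>J. w j * D * env ((x j - c j) / s j))"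
  shows "Lp_norm (leb J) p F \<le> ennreal (V * gauss_prod_bound D J w s p)"
proof -
  have "Lp_norm (leb J) p F \<le> ennreal ((V * (\<Prod>j\<in>J. w j * D)) * (\<Prod>j\<in>J. sqrt (8 * pi) * s j) powr enn2real (1 / p))"
  proof (rule Lp_norm_dominated)
    show "0 \<le> V * (\<Prod>j\<in>J. w j * D)" using assms by (intro mult_nonneg_nonneg prod_nonneg) auto
    show "\<bar>F x\<bar> \<le> V * (\<Prod>j\<in>J. w j * D) * (\<Prod>j\<in>J. env ((x j - c j) / s j))" if "x \<in> space (leb J)" for x
      using dom[OF that] by (simp add: prod.distrib mult_ac)
  qed (use assms in auto)
  also have "(\<Prod>j\<in>J. sqrt (8 * pi) * s j) powr enn2real (1 / p) =
      (\<Prod>j\<in>J. (sqrt (8 * pi) * s j) powr enn2real (1 / p))"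
    by (rule prod_powr_distrib)
  finally show ?thesis by (simp add: gauss_prod_bound_def prod.distrib mult_ac)
qed

lemma Lp_norm_gauss_prod:
  assumes "finite J" "\<And>j. j \<in> J \<Longrightarrow> 0 < s j" "1 \<le> p"
    and w: "\<And>j. j \<in> J \<Longrightarrow> 0 \<le> w j" "0 \<le> D" and P: "\<And>j. j \<in> J \<Longrightarrow> env_bound D (P j)"
  shows "Lp_norm (leb J) p (\<lambda>x. v * gauss_prod J w P c s x) \<le> ennreal (\<bar>v\<bar> * gauss_prod_bound D J w s p)"
proof (rule Lp_norm_env_prod)
  fix x
  have "\<bar>v * gauss_prod J w P c s x\<bar> = \<bar>v\<bar> * (\<Prod>j\<in>J. w j * \<bar>gauss_poly (P j) ((x j - c j) / s j)\<bar>)"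
    using w by (simp add: abs_mult gauss_prod_def abs_prod)
  also have "\<dots> \<le> \<bar>v\<bar> * (\<Prod>j\<in>J. w j * (D * env ((x j - c j) / s j)))"
    using w P by (intro mult_left_mono prod_mono conjI) (auto simp: env_bound_def)
  finally show "\<bar>v * gauss_prod J w P c s x\<bar> \<le> \<bar>v\<bar> * (\<Prod>j\<in>J. w j * D * env ((x j - c j) / s j))"
    by (simp add: mult_ac)
qed (use assms in auto)

text \<open>Only the factor at \<open>i\<close> feels the shift, and \<open>env_bound\<close>
  controls its increment by two envelopes, one for each end point. Both have the same norm bound, so
  \<open>Lp_norm_add_le\<close> gives the constant 4 + 4.\<close>

lemma Lp_norm_gauss_prod_diff:
  assumes fin: "finite J" and i: "i \<in> J" and s: "\<And>j. j \<in> J \<Longrightarrow> 0 < s j" and p: "1 \<le> p"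
    and w: "\<And>j. j \<in> J \<Longrightarrow> 0 \<le> w j" "0 \<le> D" and P: "\<And>j. j \<in> J \<Longrightarrow> env_bound D (P j)"
    and b: "0 \<le> b" "b \<le> 1"
  shows "Lp_norm (leb J) p (\<lambda>x. v * gauss_prod J w P c s (x(i := x i + t)) - v * gauss_prod J w P c s x)
    \<le> ennreal (8 * (\<bar>v\<bar> * (\<bar>t\<bar> / s i) powr b * gauss_prod_bound D J w s p))"
proof -
  define V where "V = \<bar>v\<bar> * (\<bar>t\<bar> / s i) powr b"
  have V: "0 \<le> V" by (simp add: V_def)
  \<comment> \<open>The envelope at the shifted point is an envelope with centre
    \<open>c i - t\<close>, so the same norm bound covers it.\<close>
  define c' where "c' = c(i := c i - t)"
  define A where "A c x = V * (\<Prod>j\<in>J. w j * D * env ((x j - c j) / s j))" for c x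
  have [measurable]: "A c \<in> borel_measurable (leb J)" for c unfolding A_def by measurable
  have A_nonneg: "0 \<le> A c x" for c x
    unfolding A_def using V w by (intro mult_nonneg_nonneg prod_nonneg) auto
  have bound: "Lp_norm (leb J) p (A c) \<le> ennreal (V * gauss_prod_bound D J w s p)" for c
  proof (rule Lp_norm_env_prod)
    show "\<bar>A c x\<bar> \<le> V * (\<Prod>j\<in>J. w j * D * env ((x j - c j) / s j))" for x
      using A_nonneg[of c x] by (simp add: A_def)
  qed (use assms V in auto)
  note [measurable] = measurable_compose[OF measurable_shift[OF i] measurable_gauss_prod]
  have le: "\<bar>v * gauss_prod J w P c s (x(i := x i + t)) - v * gauss_prod J w P c s x\<bar> \<le> \<bar>A c x\<bar> + \<bar>A c' x\<bar>" for x
  proof -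
    define u where "u = (x i - c i) / s i"
    have si: "0 < s i" using i s by auto
    have shift: "(x i + t - c i) / s i = u + t / s i" "(x i - c' i) / s i = u + t / s i"
      using si by (auto simp: u_def c'_def field_simps)
    let ?R = "\<Prod>j\<in>J - {i}. w j * D * env ((x j - c j) / s j)"
    have R': "(\<Prod>j\<in>J - {i}. w j * D * env ((x j - c' j) / s j)) = ?R"
      by (intro prod.cong) (auto simp: c'_def)
    have "\<bar>gauss_prod (J - {i}) w P c s x\<bar> = (\<Prod>j\<in>J - {i}. w j * \<bar>gauss_poly (P j) ((x j - c j) / s j)\<bar>)"
      using w by (simp add: abs_mult gauss_prod_def abs_prod)
    also have "\<dots> \<le> (\<Prod>j\<in>J - {i}. w j * (D * env ((x j - c j) / s j)))"
      using w P by (intro prod_mono conjI mult_left_mono) (auto simp: env_bound_def)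
    finally have 1: "\<bar>gauss_prod (J - {i}) w P c s x\<bar> \<le> ?R" by (simp add: mult_ac)
    have 2: "\<bar>gauss_poly (P i) (u + t / s i) - gauss_poly (P i) u\<bar> \<le> D * \<bar>t / s i\<bar> powr b * (env u + env (u + t / s i))"
      using P[OF i] b unfolding env_bound_def by blast
    have e: "gauss_prod J w P c s (x(i := x i + t)) = gauss_prod (J - {i}) w P c s x * (w i * gauss_poly (P i) (u + t / s i))"
      "gauss_prod J w P c s x = gauss_prod (J - {i}) w P c s x * (w i * gauss_poly (P i) u)"
      using gauss_prod_fun_upd[OF fin i, of w P c s x "x i + t"] gauss_prod_fun_upd[OF fin i, of w P c s x "x i"]
      by (simp_all only: shift(1) u_def fun_upd_triv)
    have "v * gauss_prod J w P c s (x(i := x i + t)) - v * gauss_prod J w P c s x =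
        v * (gauss_prod (J - {i}) w P c s x * (w i * (gauss_poly (P i) (u + t / s i) - gauss_poly (P i) u)))"
      unfolding e by (simp add: algebra_simps)
    then have "\<bar>v * gauss_prod J w P c s (x(i := x i + t)) - v * gauss_prod J w P c s x\<bar> =
        \<bar>v\<bar> * (\<bar>gauss_prod (J - {i}) w P c s x\<bar> * (w i * \<bar>gauss_poly (P i) (u + t / s i) - gauss_poly (P i) u\<bar>))"
      using w(1)[OF i] by (simp add: abs_mult)
    also have "\<dots> \<le> \<bar>v\<bar> * (?R * (w i * (D * \<bar>t / s i\<bar> powr b * (env u + env (u + t / s i)))))"
      using 1 2 w i by (intro mult_left_mono mult_mono) (auto intro!: prod_nonneg)
    also have "\<dots> = A c x + A c' x"
      unfolding A_def prod.remove[OF fin i] R' shift u_def[symmetric] V_def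
      using si by (simp add: algebra_simps)
    finally show ?thesis using A_nonneg by simp
  qed
  have "Lp_norm (leb J) p (\<lambda>x. v * gauss_prod J w P c s (x(i := x i + t)) - v * gauss_prod J w P c s x)
      \<le> ennreal (4 * (V * gauss_prod_bound D J w s p + V * gauss_prod_bound D J w s p))"
    using le by (intro Lp_norm_add_le[OF p _ _ _ _ _ _ bound[of c] bound[of c']])
      (auto intro!: mult_nonneg_nonneg V gauss_prod_bound_nonneg w)
  then show ?thesis by (simp add: V_def mult_ac)
qed

text \<open>Together these place the Hoelder exponent \<open>b - sfloor b\<close> in (0, 1], within
  the range of \<open>env_bound\<close>; at an integer \<open>b\<close> it is 1.\<close>

lemma sfloor_less: "0 < b \<Longrightarrow> real (sfloor b) < b" and le_sfloor: "0 < b \<Longrightarrow> b \<le> real (sfloor b) + 1"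
  unfolding sfloor_def by linarith+

text \<open>
  The first alternative of \<open>deriv_bound\<close> is for \<open>p i = 1\<close>, where the norm of a density is \<open>1\<close> at every scale.
\<close>

lemma nikolskii_mix:
  fixes J w w' P P' s s' c v v'
  defines "F \<equiv> \<lambda>x. v * gauss_prod J w P c s x + v' * gauss_prod J w' P' c s' x"
  assumes fin: "finite J" and D: "0 \<le> D"
    and w: "\<And>j. j \<in> J \<Longrightarrow> 0 \<le> w j" "\<And>j. j \<in> J \<Longrightarrow> 0 \<le> w' j"
    and s: "\<And>j. j \<in> J \<Longrightarrow> 0 < s j" "\<And>j. j \<in> J \<Longrightarrow> 0 < s' j"
    and P: "\<And>j k. j \<in> J \<Longrightarrow> k \<le> K \<Longrightarrow> env_bound D ((gauss_step ^^ k) (P j))"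
    and P': "\<And>j k. j \<in> J \<Longrightarrow> k \<le> K \<Longrightarrow> env_bound D ((gauss_step ^^ k) (P' j))"
    and \<beta>: "\<And>i. i \<in> J \<Longrightarrow> 0 < \<beta> i" "\<And>i. i \<in> J \<Longrightarrow> sfloor (\<beta> i) \<le> K"
    and p: "\<And>i. i \<in> J \<Longrightarrow> 1 \<le> p i"
    and deriv_bound: "\<And>i k. i \<in> J \<Longrightarrow> k \<le> sfloor (\<beta> i) \<Longrightarrow>
      (k = 0 \<and> Lp_norm (leb J) (p i) F \<le> ennreal (L i)) \<or>
      4 * (\<bar>v\<bar> * (gauss_prod_bound D J w s (p i) / s i ^ k) + \<bar>v'\<bar> * (gauss_prod_bound D J w' s' (p i) / s' i ^ k)) \<le> L i"
    and diff_bound: "\<And>i. i \<in> J \<Longrightarrow> 32 * (\<bar>v\<bar> * (gauss_prod_bound D J w s (p i) / s i powr \<beta> i) +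
      \<bar>v'\<bar> * (gauss_prod_bound D J w' s' (p i) / s' i powr \<beta> i)) \<le> L i"
  shows "F \<in> nikolskii J p \<beta> L"
  unfolding nikolskii_def
proof (intro CollectI conjI ballI allI impI)
  show [measurable]: "F \<in> borel_measurable (leb J)" unfolding F_def by measurable
next
  fix i k x t assume i: "i \<in> J"
  show "(deriv ^^ k) (\<lambda>u. F (x(i := u))) field_differentiable at t"
    unfolding F_def using fin i s(1)[OF i] s(2)[OF i] by (intro differentiable_mix) auto
next
  fix i k assume i: "i \<in> J" and k: "k \<le> sfloor (\<beta> i)"
  have si: "s i \<noteq> 0" "s' i \<noteq> 0" using s(1)[OF i] s(2)[OF i] by auto
  let ?w = "w(i := w i / s i ^ k)" let ?w' = "w'(i := w' i / s' i ^ k)"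
  let ?P = "P(i := (gauss_step ^^ k) (P i))" let ?P' = "P'(i := (gauss_step ^^ k) (P' i))"
  have w': "\<And>j. j \<in> J \<Longrightarrow> 0 \<le> ?w j" "\<And>j. j \<in> J \<Longrightarrow> 0 \<le> ?w' j" using w s by (auto simp: less_imp_le)
  \<comment> \<open>Coordinates other than \<open>i\<close> keep the undifferentiated polynomial,
    which is the instance \<open>k = 0\<close> of the hypotheses.\<close>
  have PP: "\<And>j. j \<in> J \<Longrightarrow> env_bound D (?P j)" "\<And>j. j \<in> J \<Longrightarrow> env_bound D (?P' j)"
    using P P' k \<beta>(2)[OF i] P[of _ 0] P'[of _ 0] by auto
  show "Lp_norm (leb J) (p i) (pderiv_i i k F) \<le> ennreal (L i)"
  proof (cases "k = 0 \<and> Lp_norm (leb J) (p i) F \<le> ennreal (L i)")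
    case True
    moreover have "pderiv_i i 0 F = F" by (simp add: pderiv_i_def fun_eq_iff)
    ultimately show ?thesis by simp
  next
    case False
    then have le: "4 * (\<bar>v\<bar> * gauss_prod_bound D J ?w s (p i) + \<bar>v'\<bar> * gauss_prod_bound D J ?w' s' (p i)) \<le> L i"
      using deriv_bound[OF i k] unfolding gauss_prod_bound_fun_upd[OF fin i] by blast
    have "Lp_norm (leb J) (p i) (pderiv_i i k F) \<le>
        ennreal (4 * (\<bar>v\<bar> * gauss_prod_bound D J ?w s (p i) + \<bar>v'\<bar> * gauss_prod_bound D J ?w' s' (p i)))"
      unfolding F_def pderiv_mix[where s = s and s' = s', OF fin i si]
    proof (rule Lp_norm_add_le[OF p[OF i]])
      show "Lp_norm (leb J) (p i) (\<lambda>x. v * gauss_prod J ?w ?P c s x) \<le> ennreal (\<bar>v\<bar> * gauss_prod_bound D J ?w s (p i))"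
        using fin s(1) p[OF i] w'(1) D PP(1) by (rule Lp_norm_gauss_prod)
      show "Lp_norm (leb J) (p i) (\<lambda>x. v' * gauss_prod J ?w' ?P' c s' x) \<le> ennreal (\<bar>v'\<bar> * gauss_prod_bound D J ?w' s' (p i))"
        using fin s(2) p[OF i] w'(2) D PP(2) by (rule Lp_norm_gauss_prod)
    qed (use w' D in \<open>auto intro!: mult_nonneg_nonneg gauss_prod_bound_nonneg\<close>)
    also have "\<dots> \<le> ennreal (L i)" using le by (rule ennreal_leI)
    finally show ?thesis .
  qed
next
  fix i t assume i: "i \<in> J"
  define k where "k = sfloor (\<beta> i)"
  define b where "b = \<beta> i - real k"
  have b: "0 \<le> b" "b \<le> 1" using sfloor_less[OF \<beta>(1)[OF i]] le_sfloor[OF \<beta>(1)[OF i]] by (auto simp: b_def k_def)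
  have si: "s i \<noteq> 0" "s' i \<noteq> 0" "0 < s i" "0 < s' i" using s(1)[OF i] s(2)[OF i] by auto
  let ?w = "w(i := w i / s i ^ k)" let ?w' = "w'(i := w' i / s' i ^ k)"
  let ?P = "P(i := (gauss_step ^^ k) (P i))" let ?P' = "P'(i := (gauss_step ^^ k) (P' i))"
  have w': "\<And>j. j \<in> J \<Longrightarrow> 0 \<le> ?w j" "\<And>j. j \<in> J \<Longrightarrow> 0 \<le> ?w' j" using w s by (auto simp: less_imp_le)
  have PP: "\<And>j. j \<in> J \<Longrightarrow> env_bound D (?P j)" "\<And>j. j \<in> J \<Longrightarrow> env_bound D (?P' j)"
    using P P' \<beta>(2)[OF i] P[of _ 0] P'[of _ 0] by (auto simp: k_def)
  let ?A = "\<lambda>x. v * gauss_prod J ?w ?P c s x" let ?B = "\<lambda>x. v' * gauss_prod J ?w' ?P' c s' x"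
  let ?U = "8 * (\<bar>v\<bar> * (\<bar>t\<bar> / s i) powr b * gauss_prod_bound D J ?w s (p i))"
  let ?V = "8 * (\<bar>v'\<bar> * (\<bar>t\<bar> / s' i) powr b * gauss_prod_bound D J ?w' s' (p i))"
  note [measurable] = measurable_compose[OF measurable_shift[OF i] measurable_gauss_prod]
  have "Lp_norm (leb J) (p i) (\<lambda>x. pderiv_i i k F (x(i := x i + t)) - pderiv_i i k F x) \<le> ennreal (4 * (?U + ?V))"
    unfolding F_def pderiv_mix[where s = s and s' = s', OF fin i si(1,2)]
  proof (rule Lp_norm_add_le[OF p[OF i]])
    show "Lp_norm (leb J) (p i) (\<lambda>x. ?A (x(i := x i + t)) - ?A x) \<le> ennreal ?U"
      using fin i s(1) p[OF i] w'(1) D PP(1) b by (rule Lp_norm_gauss_prod_diff)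
    show "Lp_norm (leb J) (p i) (\<lambda>x. ?B (x(i := x i + t)) - ?B x) \<le> ennreal ?V"
      using fin i s(2) p[OF i] w'(2) D PP(2) b by (rule Lp_norm_gauss_prod_diff)
  qed (use w' D in \<open>auto intro!: mult_nonneg_nonneg gauss_prod_bound_nonneg\<close>)
  \<comment> \<open>The derivatives divide by \<open>s i ^ k\<close> and the increment by
    \<open>s i powr b\<close>, in total by \<open>s i powr \<beta> i\<close>; the constant is 4 * 8
    = 32.\<close>
  also have "4 * (?U + ?V) = \<bar>t\<bar> powr b * (32 * (\<bar>v\<bar> * (gauss_prod_bound D J w s (p i) / s i powr \<beta> i) +
      \<bar>v'\<bar> * (gauss_prod_bound D J w' s' (p i) / s' i powr \<beta> i)))"
  proof -
    have split: "z powr \<beta> i = z ^ k * z powr b" if "0 < z" for z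
      using that by (simp add: b_def powr_diff powr_realpow)
    show ?thesis
      using si by (simp add: gauss_prod_bound_fun_upd[OF fin i] powr_divide split field_simps)
  qed
  also have "ennreal \<dots> \<le> ennreal (\<bar>t\<bar> powr b * L i)"
    using diff_bound[OF i] by (intro ennreal_leI mult_left_mono) auto
  finally show "Lp_norm (leb J) (p i) (\<lambda>x. pderiv_i i (sfloor (\<beta> i)) F (x(i := x i + t)) - pderiv_i i (sfloor (\<beta> i)) F x)
      \<le> ennreal (L i * \<bar>t\<bar> powr (\<beta> i - real (sfloor (\<beta> i))))"
    unfolding k_def b_def by (simp only: mult.commute)
qed

section \<open>Marginals, integrals and block structure of products\<close>

lemma gauss_prod_merge:
  assumes "finite A" "J \<subseteq> A"
  shows "gauss_prod A w P c s (merge J (A - J) (x, y)) = gauss_prod J w P c s x * gauss_prod (A - J) w P c s y"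
proof -
  have "gauss_prod A w P c s (merge J (A - J) (x, y)) =
      gauss_prod J w P c s (merge J (A - J) (x, y)) * gauss_prod (A - J) w P c s (merge J (A - J) (x, y))"
    unfolding gauss_prod_def using prod.subset_diff[OF assms(2,1)] by (subst mult.commute)
  also have "gauss_prod J w P c s (merge J (A - J) (x, y)) = gauss_prod J w P c s x"
    unfolding gauss_prod_def by (intro prod.cong) (auto simp: merge_def)
  also have "gauss_prod (A - J) w P c s (merge J (A - J) (x, y)) = gauss_prod (A - J) w P c s y"
    unfolding gauss_prod_def by (intro prod.cong) (auto simp: merge_def)
  finally show ?thesis .
qed

lemma has_integral_gauss_prod:
  assumes "finite J" "\<And>j. j \<in> J \<Longrightarrow> 0 < s j"
    and "\<And>j. j \<in> J \<Longrightarrow> has_bochner_integral lborel (gauss_poly (P j)) (\<mu> j)"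
  shows "has_bochner_integral (leb J) (gauss_prod J w P c s) (\<Prod>j\<in>J. w j * s j * \<mu> j)"
proof -
  interpret product_sigma_finite "\<lambda>_::nat. lborel :: real measure" by standard
  have *: "has_bochner_integral lborel (\<lambda>x. w j * gauss_poly (P j) ((x - c j) / s j)) (w j * s j * \<mu> j)" if "j \<in> J" for j
    using assms that by (intro has_integral_gauss_poly_affine) auto
  then have "integrable (leb J) (\<lambda>x. \<Prod>j\<in>J. w j * gauss_poly (P j) ((x j - c j) / s j))"
    using assms(1) by (intro product_integrable_prod) (auto simp: has_bochner_integral_iff)
  moreover have "(\<integral>x. (\<Prod>j\<in>J. w j * gauss_poly (P j) ((x j - c j) / s j)) \<partial>leb J) = (\<Prod>j\<in>J. w j * s j * \<mu> j)"
    using assms(1) * by (subst product_integral_prod) (auto simp: has_bochner_integral_iff intro!: prod.cong)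
  ultimately show ?thesis unfolding has_bochner_integral_iff gauss_prod_def[abs_def] by simp
qed

lemma gauss_prod_restrict: "gauss_prod J w P c s (restrict x J) = gauss_prod J w P c s x"
  unfolding gauss_prod_def by (intro prod.cong) auto

lemma gauss_prod_partition:
  assumes "partition_on A \<P>" "finite A"
  shows "(\<Prod>J\<in>\<P>. gauss_prod J w P c s x) = gauss_prod A w P c s x"
proof -
  have "A = \<Union>\<P>" using assms(1) by (simp add: partition_on_def)
  moreover have "\<forall>J\<in>\<P>. finite J" using assms by (auto simp: partition_on_def intro: finite_subset)
  moreover have "\<forall>J\<in>\<P>. \<forall>J'\<in>\<P>. J \<noteq> J' \<longrightarrow> J \<inter> J' = {}"
    using assms(1) by (auto simp: partition_on_def disjoint_def)
  ultimately show ?thesis unfolding gauss_prod_def by (simp add: prod.Union_disjoint)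
qed

text \<open>The last clause isolates \<open>p = 1\<close>, the exponent at which the norm of a
  density does not shrink as its scale grows.\<close>

lemma exponent_bounds:
  fixes p :: ennreal
  assumes "1 \<le> p"
  shows "0 \<le> enn2real (1 / p)" "enn2real (1 / p) \<le> 1" "enn2real (1 / p) = 1 \<Longrightarrow> p = 1"
  using assms by (cases rule: exponent_cases; auto)+

section \<open>The two-point lower bound\<close>

text \<open>Boxes determine the product measure, and on a box the indicator is a product, so Tonelli
  applies. This passes from the likelihood ratio of one observation to that of a sample.\<close>

lemma PiM_density:
  fixes r :: "'b \<Rightarrow> ennreal"
  assumes "finite I" "prob_space M" "prob_space (density M r)" and [measurable]: "r \<in> borel_measurable M"
  shows "PiM I (\<lambda>_. density M r) = density (PiM I (\<lambda>_. M)) (\<lambda>x. \<Prod>i\<in>I. r (x i))"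
proof -
  interpret M: prob_space M by fact
  interpret D: prob_space "density M r" by fact
  interpret PM: product_prob_space "\<lambda>_. M" I by unfold_locales
  interpret PD: product_prob_space "\<lambda>_. density M r" I by unfold_locales
  show ?thesis
  proof (rule PD.PiM_eqI[symmetric])
    show "finite I" by fact
    show "sets (density (PiM I (\<lambda>_. M)) (\<lambda>x. \<Prod>i\<in>I. r (x i))) = sets (PiM I (\<lambda>_. density M r))"
      by (simp cong: sets_PiM_cong)
    fix A assume A: "\<And>i. i \<in> I \<Longrightarrow> A i \<in> sets (density M r)"
    then have [measurable]: "Pi\<^sub>E I A \<in> sets (PiM I (\<lambda>_. M))"
      using \<open>finite I\<close> by (intro sets_PiM_I_finite) auto
    have "emeasure (density (PiM I (\<lambda>_. M)) (\<lambda>x. \<Prod>i\<in>I. r (x i))) (Pi\<^sub>E I A) =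
        (\<integral>\<^sup>+ x. (\<Prod>i\<in>I. r (x i)) * indicator (Pi\<^sub>E I A) x \<partial>PiM I (\<lambda>_. M))"
      using \<open>finite I\<close> by (intro emeasure_density) measurable
    also have "\<dots> = (\<integral>\<^sup>+ x. (\<Prod>i\<in>I. r (x i) * indicator (A i) (x i)) \<partial>PiM I (\<lambda>_. M))"
    proof (intro nn_integral_cong)
      fix x assume x: "x \<in> space (PiM I (\<lambda>_. M))"
      have "indicator (Pi\<^sub>E I A) x = (\<Prod>i\<in>I. indicator (A i) (x i) :: ennreal)"
      proof (cases "\<forall>i\<in>I. x i \<in> A i")
        case True
        then show ?thesis using x by (auto simp: space_PiM PiE_iff)
      next
        case False
        then obtain j where "j \<in> I" "x j \<notin> A j" by blast
        then show ?thesis using \<open>finite I\<close> by (auto simp: PiE_iff prod_zero_iff indicator_def)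
      qed
      then show "(\<Prod>i\<in>I. r (x i)) * indicator (Pi\<^sub>E I A) x = (\<Prod>i\<in>I. r (x i) * indicator (A i) (x i))"
        by (simp add: prod.distrib)
    qed
    also have "\<dots> = (\<Prod>i\<in>I. \<integral>\<^sup>+ x. r x * indicator (A i) x \<partial>M)"
      using \<open>finite I\<close> A by (intro PM.product_nn_integral_prod) auto
    also have "\<dots> = (\<Prod>i\<in>I. emeasure (density M r) (A i))"
      using A by (intro prod.cong refl emeasure_density[symmetric]) auto
    finally show "emeasure (density (PiM I (\<lambda>_. M)) (\<lambda>x. \<Prod>i\<in>I. r (x i))) (Pi\<^sub>E I A) =
        (\<Prod>i\<in>I. emeasure (density M r) (A i))" .
  qed
qed

text \<open>Here \<open>w\<close> is the likelihood ratio of the second law to \<open>P\<close>, and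
  \<open>a\<close>, \<open>b\<close> are the two losses. On the event \<open>B\<close> that
  \<open>b\<close> is small, \<open>a\<close> is at least \<open>K\<close>. Either \<open>B\<close>
  has probability at least 1/16 under \<open>P\<close>, or at most 1/2 under the second law by the
  second moment of \<open>w\<close>.\<close>

lemma two_point_bound:
  fixes w a b :: "'a \<Rightarrow> real"
  assumes "prob_space P"
    and [measurable]: "w \<in> borel_measurable P" "a \<in> borel_measurable P" "b \<in> borel_measurable P"
    and w0: "\<And>x. x \<in> space P \<Longrightarrow> 0 \<le> w x"
    and w1: "(\<integral>\<^sup>+ x. ennreal (w x) \<partial>P) = 1"
    and w2: "(\<integral>\<^sup>+ x. ennreal ((w x)\<^sup>2) \<partial>P) \<le> 4"
    and K: "0 \<le> K" "\<And>x. x \<in> space P \<Longrightarrow> K \<le> a x \<or> K \<le> b x"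
  shows "ennreal (K / 16) \<le> (\<integral>\<^sup>+ x. ennreal (a x) \<partial>P) \<or>
    ennreal (K / 16) \<le> (\<integral>\<^sup>+ x. ennreal (w x * b x) \<partial>P)"
proof -
  interpret prob_space P by fact
  define B where "B = {x \<in> space P. b x < K}"
  have [measurable]: "B \<in> sets P" unfolding B_def by measurable
  show ?thesis
  proof (cases "prob B < 1 / 16")
    case False
    have "ennreal (K / 16) \<le> ennreal (K * prob B)"
      using False K(1) by (intro ennreal_leI) (auto simp: mult_left_mono[of "1/16" "prob B" K, simplified])
    also have "\<dots> = (\<integral>\<^sup>+ x. ennreal K * indicator B x \<partial>P)"
      using K(1) by (simp add: nn_integral_cmult emeasure_eq_measure ennreal_mult)
    also have "\<dots> \<le> (\<integral>\<^sup>+ x. ennreal (a x) \<partial>P)"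
      using K(2) by (intro nn_integral_mono) (force simp: B_def indicator_def ennreal_leI)
    finally show ?thesis by blast
  next
    case True
    have "(\<integral>\<^sup>+ x. ennreal (w x) * indicator B x \<partial>P) \<le>
        (\<integral>\<^sup>+ x. ennreal (1/16) * ennreal ((w x)\<^sup>2) + ennreal 4 * indicator B x \<partial>P)"
    proof (intro nn_integral_mono)
      fix x assume x: "x \<in> space P"
      \<comment> \<open>A linear substitute for the Cauchy-Schwarz inequality, balanced so that the
        second moment 4 and the probability 1/16 contribute 1/4 each.\<close>
      have "0 \<le> (w x / 4 - 2)\<^sup>2" by simp
      then have "w x \<le> 1/16 * (w x)\<^sup>2 + 4" by (simp add: power2_eq_square algebra_simps)
      then have "ennreal (w x) \<le> ennreal (1/16 * (w x)\<^sup>2 + 4)" by (rule ennreal_leI)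
      also have "\<dots> = ennreal (1/16) * ennreal ((w x)\<^sup>2) + ennreal 4"
        by (subst ennreal_plus) (auto simp: ennreal_mult'[symmetric])
      finally show "ennreal (w x) * indicator B x \<le>
          ennreal (1/16) * ennreal ((w x)\<^sup>2) + ennreal 4 * indicator B x"
        by (auto simp: indicator_def)
    qed
    also have "\<dots> = ennreal (1/16) * (\<integral>\<^sup>+ x. ennreal ((w x)\<^sup>2) \<partial>P) + ennreal 4 * emeasure P B"
      by (subst nn_integral_add) (auto simp: nn_integral_cmult)
    also have "\<dots> \<le> ennreal (1/16) * ennreal 4 + ennreal 4 * ennreal (1/16)"
      using w2 True by (intro add_mono mult_left_mono) (auto simp: emeasure_eq_measure intro!: ennreal_leI)
    also have "\<dots> = ennreal (1/2)"
      by (simp flip: ennreal_mult ennreal_plus del: ennreal_numeral)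
    finally have B: "(\<integral>\<^sup>+ x. ennreal (w x) * indicator B x \<partial>P) \<le> ennreal (1/2)" .
    define v where "v = (\<integral>\<^sup>+ x. ennreal (w x) * indicator (space P - B) x \<partial>P)"
    have "1 = (\<integral>\<^sup>+ x. ennreal (w x) * indicator B x + ennreal (w x) * indicator (space P - B) x \<partial>P)"
      unfolding w1[symmetric] by (intro nn_integral_cong) (auto simp: indicator_def)
    also have "\<dots> = (\<integral>\<^sup>+ x. ennreal (w x) * indicator B x \<partial>P) + v"
      unfolding v_def by (rule nn_integral_add) auto
    also have "\<dots> \<le> ennreal (1/2) + v" using B by (rule add_right_mono)
    finally have "1 \<le> ennreal (1/2) + v" .
    then have v: "ennreal (1/16) \<le> v"
    proof (cases v)
      case (real r)
      then have "ennreal 1 \<le> ennreal (1/2 + r)" using \<open>1 \<le> ennreal (1/2) + v\<close> by simp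
      then have "1 \<le> 1/2 + r" using real(1) by (subst (asm) ennreal_le_iff) auto
      then show ?thesis using real by (auto intro!: ennreal_leI)
    qed simp
    have "ennreal (K / 16) = ennreal K * ennreal (1/16)" using K(1) by (simp flip: ennreal_mult)
    also have "\<dots> \<le> ennreal K * v" using v by (rule mult_left_mono) simp
    also have "\<dots> = (\<integral>\<^sup>+ x. ennreal K * (ennreal (w x) * indicator (space P - B) x) \<partial>P)"
      unfolding v_def by (rule nn_integral_cmult[symmetric]) measurable
    also have "\<dots> \<le> (\<integral>\<^sup>+ x. ennreal (w x * b x) \<partial>P)"
    proof (intro nn_integral_mono)
      fix x assume x: "x \<in> space P"
      show "ennreal K * (ennreal (w x) * indicator (space P - B) x) \<le> ennreal (w x * b x)"
      proof (cases "x \<in> B")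
        case False
        then have "w x * K \<le> w x * b x" using x w0[OF x] by (intro mult_left_mono) (auto simp: B_def)
        then show ?thesis using False x w0[OF x] K(1)
          by (auto simp: indicator_def mult.commute intro!: ennreal_leI simp flip: ennreal_mult)
      qed simp
    qed
    finally show ?thesis by blast
  qed
qed

lemma prob_space_density:
  assumes "f \<in> prob_densities d"
  shows "prob_space (density (leb {1..d}) (\<lambda>x. ennreal (f x)))"
proof
  define N where "N = leb {1..d}"
  have [measurable]: "f \<in> borel_measurable N" using assms by (simp add: prob_densities_def N_def)
  have "emeasure (density N (\<lambda>x. ennreal (f x))) (space N) = (\<integral>\<^sup>+ x. ennreal (f x) \<partial>N)"
    by (subst emeasure_density) (auto intro!: nn_integral_cong)
  then show "emeasure (density (leb {1..d}) (\<lambda>x. ennreal (f x)))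
      (space (density (leb {1..d}) (\<lambda>x. ennreal (f x)))) = 1"
    using assms by (simp add: prob_densities_def N_def)
qed

lemma epowr_mono:
  assumes "0 \<le> v" "0 \<le> s" "ennreal v \<le> w"
  shows "ennreal (v powr s) \<le> epowr w s"
proof (cases w)
  case (real r)
  then have "v \<le> r" using assms by simp
  then show ?thesis using real assms by (auto simp: epowr_def intro!: ennreal_leI powr_mono2)
qed (simp add: epowr_def)

text \<open>By independence the second moment of the likelihood ratio is the \<open>n\<close>-th
  power of the integral in \<open>chi\<close>, at most
  \<open>(1 + \<eta>) ^ n \<le> exp 1 \<le> 4\<close>. By the triangle inequality \<open>T\<close>
  misses one of the two values by at least \<open>\<delta> / 2\<close>.\<close>

lemma two_point_risk:
  assumes f0: "f0 \<in> \<Sigma>" "f0 \<in> prob_densities d" and f1: "f1 \<in> \<Sigma>" "f1 \<in> prob_densities d"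
    and pos: "\<And>x. x \<in> space (leb {1..d}) \<Longrightarrow> 0 < f0 x"
    and chi: "(\<integral>\<^sup>+ x. ennreal ((f1 x)\<^sup>2 / f0 x) \<partial>leb {1..d}) \<le> ennreal (1 + \<eta>)" "0 \<le> \<eta>" "real n * \<eta> \<le> 1"
    and \<delta>: "0 \<le> \<delta>" "\<delta> \<le> \<bar>f1 x0 - f0 x0\<bar>"
    and q: "1 \<le> q" and T: "T \<in> estimators d n"
  shows "ennreal (\<delta> / 32) \<le> max_risk d n q x0 T \<Sigma>"
proof -
  define N where "N = leb {1..d}"
  have [measurable]: "f0 \<in> borel_measurable N" "f1 \<in> borel_measurable N"
    using f0 f1 by (auto simp: prob_densities_def N_def)
  have f1_nonneg: "0 \<le> f1 x" if "x \<in> space N" for x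
    using that f1 by (auto simp: prob_densities_def N_def)
  have pos: "0 < f0 x" if "x \<in> space N" for x using that pos by (auto simp: N_def)
  define M where "M = density N (\<lambda>x. ennreal (f0 x))"
  define r where "r x = f1 x / f0 x" for x
  have space_M: "space M = space N" by (simp add: M_def)
  have [measurable]: "r \<in> borel_measurable N" "r \<in> borel_measurable M" unfolding r_def M_def by measurable
  have r_nonneg: "0 \<le> r x" if "x \<in> space N" for x
    using pos[OF that] f1_nonneg[OF that] by (simp add: r_def)
  have dens: "density M (\<lambda>x. ennreal (r x)) = density N (\<lambda>x. ennreal (f1 x))"
  proof -
    have "density M (\<lambda>x. ennreal (r x)) = density N (\<lambda>x. ennreal (f0 x) * ennreal (r x))"
      unfolding M_def by (rule density_density_eq) measurable
    also have "\<dots> = density N (\<lambda>x. ennreal (f1 x))"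
    proof (rule density_cong)
      show "AE x in N. ennreal (f0 x) * ennreal (r x) = ennreal (f1 x)"
      proof (rule AE_I2)
        fix x assume x: "x \<in> space N"
        then have "f0 x * r x = f1 x" using pos[OF x] by (simp add: r_def)
        then show "ennreal (f0 x) * ennreal (r x) = ennreal (f1 x)"
          using pos[OF x] r_nonneg[OF x] by (simp flip: ennreal_mult)
      qed
    qed measurable
    finally show ?thesis .
  qed
  have pM: "prob_space M" using prob_space_density[OF f0(2)] by (simp add: M_def N_def)
  have pD: "prob_space (density M (\<lambda>x. ennreal (r x)))"
    using prob_space_density[OF f1(2)] dens by (simp add: N_def)
  interpret M: prob_space M by fact
  interpret PM: product_prob_space "\<lambda>_. M" "{1..n}" by unfold_locales
  define P where "P = PiM {1..n} (\<lambda>_. M)"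
  define w where "w X = (\<Prod>i\<in>{1..n}. r (X i))" for X
  have [measurable]: "w \<in> borel_measurable P" unfolding w_def P_def by measurable
  have [measurable]: "T \<in> borel_measurable P"
  proof -
    have "sets P = sets (PiM {1..n} (\<lambda>_. leb {1..d}))"
      unfolding P_def by (intro sets_PiM_cong) (auto simp: M_def N_def)
    then show ?thesis using T measurable_cong_sets by (auto simp: estimators_def)
  qed
  have law0: "sample_law d n f0 = P" by (simp add: sample_law_def P_def M_def N_def)
  have r_nonneg': "0 \<le> r (X i)" if "X \<in> space P" "i \<in> {1..n}" for X i
    using that r_nonneg by (auto simp: P_def space_PiM PiE_iff space_M)
  have w_nonneg: "0 \<le> w X" if "X \<in> space P" for X
    unfolding w_def using r_nonneg'[OF that] by (intro prod_nonneg) auto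
  have law1: "sample_law d n f1 = density P (\<lambda>X. ennreal (w X))"
  proof -
    have "sample_law d n f1 = PiM {1..n} (\<lambda>_. density M (\<lambda>x. ennreal (r x)))"
      by (simp add: sample_law_def dens N_def)
    also have "\<dots> = density P (\<lambda>X. \<Prod>i\<in>{1..n}. ennreal (r (X i)))"
      unfolding P_def using pM pD by (intro PiM_density) auto
    also have "\<dots> = density P (\<lambda>X. ennreal (w X))"
    proof (rule density_cong)
      show "(\<lambda>X. \<Prod>i\<in>{1..n}. ennreal (r (X i))) \<in> borel_measurable P"
        unfolding P_def by measurable
      show "AE X in P. (\<Prod>i\<in>{1..n}. ennreal (r (X i))) = ennreal (w X)"
        unfolding w_def using r_nonneg' by (intro AE_I2) (auto intro!: prod_ennreal)
    qed measurable
    finally show ?thesis .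
  qed
  have int_w: "(\<integral>\<^sup>+ X. ennreal (w X) \<partial>P) = 1"
  proof -
    interpret L: prob_space "sample_law d n f1"
      unfolding sample_law_def by (intro prob_space_PiM prob_space_density f1)
    have "1 = emeasure (density P (\<lambda>X. ennreal (w X))) (space P)"
      using L.emeasure_space_1 by (simp add: law1)
    also have "\<dots> = (\<integral>\<^sup>+ X. ennreal (w X) \<partial>P)"
      by (subst emeasure_density) (auto intro!: nn_integral_cong)
    finally show ?thesis by simp
  qed
  have int_w2: "(\<integral>\<^sup>+ X. ennreal ((w X)\<^sup>2) \<partial>P) \<le> 4"
  proof -
    have "(\<integral>\<^sup>+ X. ennreal ((w X)\<^sup>2) \<partial>P) = (\<integral>\<^sup>+ X. (\<Prod>i\<in>{1..n}. ennreal ((r (X i))\<^sup>2)) \<partial>P)"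
      by (intro nn_integral_cong) (auto simp: w_def prod_power_distrib prod_ennreal)
    also have "\<dots> = (\<integral>\<^sup>+ x. ennreal ((r x)\<^sup>2) \<partial>M) ^ n"
      unfolding P_def by (subst PM.product_nn_integral_prod) auto
    also have "(\<integral>\<^sup>+ x. ennreal ((r x)\<^sup>2) \<partial>M) = (\<integral>\<^sup>+ x. ennreal (f0 x) * ennreal ((r x)\<^sup>2) \<partial>N)"
      unfolding M_def by (rule nn_integral_density) measurable
    also have "\<dots> = (\<integral>\<^sup>+ x. ennreal ((f1 x)\<^sup>2 / f0 x) \<partial>N)"
    proof (intro nn_integral_cong)
      fix x assume "x \<in> space N"
      then have "0 < f0 x" by (rule pos)
      then have "f0 x * (r x)\<^sup>2 = (f1 x)\<^sup>2 / f0 x"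
        by (simp add: r_def field_simps power2_eq_square)
      then show "ennreal (f0 x) * ennreal ((r x)\<^sup>2) = ennreal ((f1 x)\<^sup>2 / f0 x)"
        using \<open>0 < f0 x\<close> by (simp flip: ennreal_mult)
    qed
    also have "\<dots> ^ n \<le> ennreal (1 + \<eta>) ^ n"
      using chi(1) by (intro power_mono) (auto simp: N_def)
    also have "\<dots> \<le> ennreal 4"
    proof -
      have "(1 + \<eta>) ^ n \<le> exp \<eta> ^ n"
        using chi(2) by (intro power_mono exp_ge_add_one_self) auto
      also have "\<dots> = exp (real n * \<eta>)" by (simp add: exp_of_nat_mult)
      also have "\<dots> \<le> exp 1" using chi(3) by simp
      also have "\<dots> \<le> 4" using exp_le by simp
      finally show ?thesis using chi(2)
        by (simp add: ennreal_power ennreal_leI del: ennreal_numeral ennreal_plus)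
    qed
    finally show ?thesis by simp
  qed
  define K where "K = (\<delta> / 2) powr q"
  have K: "K \<le> \<bar>T X - f0 x0\<bar> powr q \<or> K \<le> \<bar>T X - f1 x0\<bar> powr q" for X
  proof -
    have "\<delta> / 2 \<le> \<bar>T X - f0 x0\<bar> \<or> \<delta> / 2 \<le> \<bar>T X - f1 x0\<bar>" using \<delta>(2) by linarith
    then show ?thesis unfolding K_def using \<delta>(1) q by (auto intro: powr_mono2)
  qed
  have risk: "ennreal (\<delta> / 32) \<le> epowr v (1 / q)" if "ennreal (K / 16) \<le> v" for v
  proof -
    \<comment> \<open>As \<open>q \<ge> 1\<close>, the \<open>q\<close>-th root of 1/16 is at least
      1/16, so the constant 1/32 is free of \<open>q\<close>.\<close>
    have "\<delta> / 32 = \<delta> / 2 * (1 / 16) powr 1" by simp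
    also have "\<dots> \<le> \<delta> / 2 * (1 / 16) powr (1 / q)"
      using q \<delta>(1) by (intro mult_left_mono powr_mono') auto
    also have "\<dots> = (K / 16) powr (1 / q)"
      using q \<delta>(1) by (simp add: K_def powr_divide powr_powr powr_mult)
    finally have "ennreal (\<delta> / 32) \<le> ennreal ((K / 16) powr (1 / q))" by (rule ennreal_leI)
    also have "\<dots> \<le> epowr v (1 / q)" using that q by (intro epowr_mono) (auto simp: K_def)
    finally show ?thesis .
  qed
  have "ennreal (K / 16) \<le> (\<integral>\<^sup>+ X. ennreal (\<bar>T X - f0 x0\<bar> powr q) \<partial>P) \<or>
      ennreal (K / 16) \<le> (\<integral>\<^sup>+ X. ennreal (w X * \<bar>T X - f1 x0\<bar> powr q) \<partial>P)"
  proof (rule two_point_bound)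
    show "prob_space P" unfolding P_def by (rule PM.prob_space_axioms)
  qed (use K w_nonneg int_w int_w2 in \<open>auto simp: K_def\<close>)
  moreover have "(\<integral>\<^sup>+ X. ennreal (w X * \<bar>T X - f1 x0\<bar> powr q) \<partial>P) =
      (\<integral>\<^sup>+ X. ennreal (\<bar>T X - f1 x0\<bar> powr q) \<partial>sample_law d n f1)"
    unfolding law1 by (subst nn_integral_density)
      (auto intro!: nn_integral_cong simp: ennreal_mult w_nonneg)
  ultimately have "\<exists>f\<in>\<Sigma>. ennreal (K / 16) \<le> (\<integral>\<^sup>+ X. ennreal (\<bar>T X - f x0\<bar> powr q) \<partial>sample_law d n f)"
    using f0(1) f1(1) law0 by auto
  then obtain f where f: "f \<in> \<Sigma>"
      "ennreal (K / 16) \<le> (\<integral>\<^sup>+ X. ennreal (\<bar>T X - f x0\<bar> powr q) \<partial>sample_law d n f)" by blast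
  show ?thesis
    unfolding max_risk_def using risk[OF f(2)] by (rule SUP_upper2[OF f(1)])
qed

section \<open>The perturbed densities\<close>

text \<open>\<open>K\<close> bounds the orders of differentiation, and \<open>D\<close> is one
  envelope constant for all of them. The conditions on \<open>\<sigma>\<close> treat in turn the
  Hoelder seminorms, the derivatives of positive order and, for \<open>p i \<noteq> 1\<close>, the
  norms of order 0. The factor 64 is twice the 32 of \<open>nikolskii_mix\<close>: base and bump
  each get half of \<open>L i\<close>. The last condition on \<open>\<kappa>\<close> keeps the
  densities nonnegative.\<close>

locale perturbation =
  fixes d K :: nat and \<beta> L x0 :: "nat \<Rightarrow> real" and p :: "nat \<Rightarrow> ennreal" and \<P> :: "nat set set"
    and I :: "nat set" and D \<sigma> \<kappa> :: real
  assumes part: "partition_on {1..d} \<P>" and I: "I \<in> \<P>"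
    and \<beta>: "\<And>i. i \<in> {1..d} \<Longrightarrow> 0 < \<beta> i" "\<And>i. i \<in> {1..d} \<Longrightarrow> sfloor (\<beta> i) \<le> K"
    and p: "\<And>i. i \<in> {1..d} \<Longrightarrow> 1 \<le> p i"
    and L1: "\<And>i. i \<in> {1..d} \<Longrightarrow> p i = 1 \<Longrightarrow> 1 \<le> L i"
    and D: "1 \<le> D" "\<And>k. k \<le> K \<Longrightarrow> env_bound D ((gauss_step ^^ k) 1)"
      "\<And>k. k \<le> K \<Longrightarrow> env_bound D ((gauss_step ^^ k) mexican)"
    and \<sigma>: "2 \<le> \<sigma>" "\<And>i. i \<in> {1..d} \<Longrightarrow> 64 * (D * sqrt (8 * pi)) ^ d * \<sigma> powr (- \<beta> i) \<le> L i"
      "\<And>i. i \<in> {1..d} \<Longrightarrow> 64 * (D * sqrt (8 * pi)) ^ d * \<sigma> powr (- 1) \<le> L i"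
      "\<And>i. i \<in> {1..d} \<Longrightarrow> enn2real (1 / p i) < 1 \<Longrightarrow>
        64 * (D * sqrt (8 * pi)) ^ d * \<sigma> powr (- (1 - enn2real (1 / p i))) \<le> L i"
    and \<kappa>: "0 < \<kappa>" "\<And>i. i \<in> {1..d} \<Longrightarrow> 64 * (D * sqrt (8 * pi)) ^ d * \<kappa> \<le> L i"
      "\<kappa> * (D * sqrt (2 * pi) * \<sigma>) ^ d \<le> 1"
begin

text \<open>\<open>R\<close> absorbs the coordinatewise constants of the norm bounds;
  \<open>A\<close> is the constant with which the base dominates the bump.\<close>

definition "R = (D * sqrt (8 * pi)) ^ d"
definition "A = (D * sqrt (2 * pi) * \<sigma>) ^ d"

text \<open>Outside \<open>I\<close> the factors of the bump are those of the base, so that the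
  perturbed density still factorizes over the blocks. On \<open>I\<close> the weight is 1, so that
  the height does not depend on the bandwidths.\<close>

definition bump_weight :: "nat \<Rightarrow> real" where "bump_weight j = (if j \<in> I then 1 else 1 / \<sigma>)"
definition bump_poly :: "nat \<Rightarrow> real poly" where "bump_poly j = (if j \<in> I then mexican else 1)"
definition bump_scale :: "(nat \<Rightarrow> real) \<Rightarrow> nat \<Rightarrow> real" where "bump_scale h j = (if j \<in> I then h j else \<sigma>)"

definition base :: "nat set \<Rightarrow> (nat \<Rightarrow> real) \<Rightarrow> real" where
  "base J = gauss_prod J (\<lambda>_. 1 / \<sigma>) (\<lambda>_. 1) x0 (\<lambda>_. \<sigma>)"
definition bump :: "(nat \<Rightarrow> real) \<Rightarrow> nat set \<Rightarrow> (nat \<Rightarrow> real) \<Rightarrow> real" where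
  "bump h J = gauss_prod J bump_weight bump_poly x0 (bump_scale h)"
text \<open>The marginal on \<open>J\<close> of the perturbed density, which is itself the case \<open>J = {1..d}\<close>.\<close>

definition marg :: "real \<Rightarrow> (nat \<Rightarrow> real) \<Rightarrow> nat set \<Rightarrow> (nat \<Rightarrow> real) \<Rightarrow> real" where
  "marg M h J = (\<lambda>x. 1 * base J x + (if I \<subseteq> J then M else 0) * bump h J x)"

text \<open>\<open>M \<le> \<kappa>\<close> serves nonnegativity and smoothness in directions
  outside \<open>I\<close>. With \<open>h i \<le> 1\<close> the constraint at order
  \<open>\<beta> i\<close> covers all lower orders, and the bump stays below a multiple of the
  base.\<close>

definition admissible :: "real \<Rightarrow> (nat \<Rightarrow> real) \<Rightarrow> bool" where
  "admissible M h \<longleftrightarrow> 0 \<le> M \<and> M \<le> \<kappa> \<and> (\<forall>i\<in>I. 0 < h i \<and> h i \<le> 1 \<and>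
     M * (\<Prod>j\<in>I. h j) powr enn2real (1 / p i) \<le> \<kappa> * h i powr \<beta> i)"

section \<open>Domination of the bump by the base\<close>

lemma I_subset: "I \<subseteq> {1..d}" and I_nonempty: "I \<noteq> {}"
  using part I by (auto simp: partition_on_def)

lemma finite_I: "finite I" using I_subset finite_subset by blast

lemma sqrt_8_pi: "1 \<le> sqrt (8 * pi)"
  using pi_gt3 by (intro real_sqrt_ge_one) linarith

lemma sqrt_2_pi: "1 \<le> sqrt (2 * pi)"
  using pi_gt3 by (intro real_sqrt_ge_one) linarith

lemma norm_const_ge_1: "1 \<le> R" unfolding R_def using D sqrt_8_pi
  by (intro one_le_power) (metis mult_mono mult_1 order_trans zero_le_one)

lemma dom_factor_ge_1: "1 \<le> D * sqrt (2 * pi) * \<sigma>"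
proof -
  have "1 * 1 * 1 \<le> D * sqrt (2 * pi) * \<sigma>"
    using D sqrt_2_pi \<sigma> by (intro mult_mono) auto
  then show ?thesis by simp
qed

lemma dom_const_ge_1: "1 \<le> A" unfolding A_def by (intro one_le_power dom_factor_ge_1)

lemma env_bound_base: "k \<le> K \<Longrightarrow> env_bound D ((gauss_step ^^ k) 1)" by (rule D)
lemma env_bound_bump: "k \<le> K \<Longrightarrow> env_bound D ((gauss_step ^^ k) (bump_poly j))" by (simp add: bump_poly_def D)

lemma bump_weight_nonneg: "0 \<le> bump_weight j" using \<sigma> by (simp add: bump_weight_def)
lemma bump_scale_pos: "admissible M h \<Longrightarrow> 0 < bump_scale h j" using \<sigma> by (auto simp: bump_scale_def admissible_def)

text \<open>Factor by factor: outside \<open>I\<close> the factors agree, and on \<open>I\<close>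
  the bounds \<open>h j \<le> 1\<close> and \<open>\<sigma> \<ge> 2\<close> give
  \<open>(z / \<sigma>)^2 / 2 \<le> z^2 / 8 \<le> (z / h j)^2 / 8\<close>. Nonnegativity and the
  chi-square bound both rest on this.\<close>

lemma bump_le_base:
  assumes h: "admissible M h" and J: "J \<subseteq> {1..d}"
  shows "\<bar>bump h J x\<bar> \<le> A * base J x"
proof -
  have le: "bump_weight j * \<bar>gauss_poly (bump_poly j) ((x j - x0 j) / bump_scale h j)\<bar> \<le>
      (D * sqrt (2 * pi) * \<sigma>) * (1 / \<sigma> * gauss_poly 1 ((x j - x0 j) / \<sigma>))" for j
  proof (cases "j \<in> I")
    case True
    then have hj: "0 < h j" "h j \<le> 1" using h by (auto simp: admissible_def)
    define z where "z = x j - x0 j"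
    have "\<bar>gauss_poly mexican (z / h j)\<bar> \<le> D * env (z / h j)"
      using D(3)[of 0] by (simp add: env_bound_def)
    also have "env (z / h j) \<le> exp (- ((z / \<sigma>)\<^sup>2 / 2))"
    proof -
      have "(z / \<sigma>)\<^sup>2 \<le> (z / 2)\<^sup>2"
        unfolding power_divide using \<sigma>(1) by (intro divide_left_mono power_mono) auto
      moreover have "z\<^sup>2 \<le> (z / h j)\<^sup>2"
        unfolding power_divide using hj by (simp add: field_simps mult_left_le power_le_one)
      ultimately have "(z / \<sigma>)\<^sup>2 / 2 \<le> (z / h j)\<^sup>2 / 8" by (simp add: power_divide[of z 2])
      then show ?thesis by (simp add: env_def)
    qed
    also have "\<dots> = sqrt (2 * pi) * gauss_poly 1 (z / \<sigma>)"
      by (simp add: gauss_poly_def std_normal_density_def)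
    finally have "\<bar>gauss_poly mexican (z / h j)\<bar> \<le> D * (sqrt (2 * pi) * gauss_poly 1 (z / \<sigma>))"
      using D(1) by simp
    then show ?thesis using True \<sigma>(1) by (simp add: bump_weight_def bump_poly_def bump_scale_def z_def)
  next
    case False
    have "1 * (1 / \<sigma> * gauss_poly 1 ((x j - x0 j) / \<sigma>)) \<le>
        (D * sqrt (2 * pi) * \<sigma>) * (1 / \<sigma> * gauss_poly 1 ((x j - x0 j) / \<sigma>))"
      using \<sigma>(1) dom_factor_ge_1 by (intro mult_right_mono) (auto simp: gauss_poly_def)
    then show ?thesis using False \<sigma>(1) by (simp add: bump_weight_def bump_poly_def bump_scale_def gauss_poly_def)
  qed
  have "\<bar>bump h J x\<bar> = (\<Prod>j\<in>J. bump_weight j * \<bar>gauss_poly (bump_poly j) ((x j - x0 j) / bump_scale h j)\<bar>)"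
    using bump_weight_nonneg by (simp add: bump_def gauss_prod_def abs_prod abs_mult)
  also have "\<dots> \<le> (\<Prod>j\<in>J. (D * sqrt (2 * pi) * \<sigma>) * (1 / \<sigma> * gauss_poly 1 ((x j - x0 j) / \<sigma>)))"
    using le bump_weight_nonneg by (intro prod_mono) auto
  also have "\<dots> = (D * sqrt (2 * pi) * \<sigma>) ^ card J * base J x"
    unfolding base_def gauss_prod_def by (subst prod.distrib) (simp only: prod_constant)
  also have "\<dots> \<le> A * base J x"
  proof (intro mult_right_mono)
    have "card J \<le> card {1..d}" using J by (intro card_mono) auto
    then show "(D * sqrt (2 * pi) * \<sigma>) ^ card J \<le> A"
      unfolding A_def using dom_factor_ge_1 by (intro power_increasing) auto
    show "0 \<le> base J x" using \<sigma>(1) by (auto simp: base_def gauss_prod_def gauss_poly_def intro!: prod_nonneg)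
  qed
  finally show ?thesis .
qed

lemma base_pos: "0 < base J x"
  using \<sigma>(1) by (auto simp: base_def gauss_prod_def gauss_poly_def normal_density_pos intro!: prod_pos)

text \<open>From \<open>M * A \<le> \<kappa> * A \<le> 1\<close>, the base is at least
  \<open>M\<close> times the modulus of the bump.\<close>

lemma marg_nonneg:
  assumes h: "admissible M h" and J: "J \<subseteq> {1..d}"
  shows "0 \<le> marg M h J x"
proof -
  have "\<bar>M * bump h J x\<bar> \<le> \<kappa> * (A * base J x)"
    unfolding abs_mult using h bump_le_base[OF h J] by (intro mult_mono) (auto simp: admissible_def)
  also have "\<dots> \<le> 1 * base J x"
    unfolding mult.assoc[symmetric] using \<kappa>(3) base_pos[of J x]
    by (intro mult_right_mono) (auto simp: A_def)
  finally show ?thesis using base_pos[of J x] by (auto simp: marg_def)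
qed

section \<open>Integrals, marginals and product structure\<close>

lemma has_integral_base:
  assumes "finite J" shows "has_bochner_integral (leb J) (base J) 1"
  using has_integral_gauss_prod[OF assms, of "\<lambda>_. \<sigma>" "\<lambda>_. 1" "\<lambda>_. 1" "\<lambda>_. 1 / \<sigma>" x0] has_integral_gauss_poly_1 \<sigma>(1)
  by (simp add: base_def)

text \<open>A single factor on \<open>I\<close> has integral 0 and annihilates the product; the
  factors outside \<open>I\<close> are probability densities.\<close>

lemma has_integral_bump:
  assumes "finite J" "admissible M h"
  shows "has_bochner_integral (leb J) (bump h J) (if J \<inter> I = {} then 1 else 0)"
proof -
  have "has_bochner_integral (leb J) (bump h J) (\<Prod>j\<in>J. bump_weight j * bump_scale h j * (if j \<in> I then 0 else 1))"
    unfolding bump_def using assms bump_scale_pos[OF assms(2)] has_integral_gauss_poly_1 has_integral_gauss_poly_mexican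
    by (intro has_integral_gauss_prod) (auto simp: bump_poly_def)
  also have "(\<Prod>j\<in>J. bump_weight j * bump_scale h j * (if j \<in> I then 0 else 1)) = (if J \<inter> I = {} then 1 else 0)"
  proof (cases "J \<inter> I = {}")
    case True
    then have "(\<Prod>j\<in>J. bump_weight j * bump_scale h j * (if j \<in> I then 0 else 1)) = (\<Prod>j\<in>J. 1)"
      using \<sigma>(1) by (intro prod.cong) (auto simp: bump_weight_def bump_scale_def)
    then show ?thesis using True by simp
  next
    case False
    then show ?thesis using assms(1) by (auto simp: prod_zero_iff)
  qed
  finally show ?thesis .
qed

lemma has_integral_marg:
  assumes "finite J" "admissible M h"
  shows "has_bochner_integral (leb J) (marg M h J) 1"
proof -
  have "has_bochner_integral (leb J) (marg M h J)
      (1 * 1 + (if I \<subseteq> J then M else 0) * (if J \<inter> I = {} then 1 else 0))"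
    unfolding marg_def using assms
    by (intro has_bochner_integral_add has_bochner_integral_mult_right has_integral_base has_integral_bump)
  moreover have "(if I \<subseteq> J then M else 0) * (if J \<inter> I = {} then 1 else 0) = 0" using I_nonempty by auto
  ultimately show ?thesis by simp
qed

lemma measurable_marg [measurable]: "marg M h J \<in> borel_measurable (leb J)"
  unfolding marg_def base_def bump_def by measurable

lemma nn_integral_marg:
  assumes "J \<subseteq> {1..d}" "admissible M h"
  shows "(\<integral>\<^sup>+ x. ennreal (marg M h J x) \<partial>leb J) = 1"
  using has_integral_marg[OF _ assms(2), of J] assms finite_subset[OF assms(1)]
  by (subst nn_integral_eq_integral) (auto simp: has_bochner_integral_iff marg_nonneg)

lemma marg_mem_prob_densities:
  assumes "admissible M h" shows "marg M h {1..d} \<in> prob_densities d"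
  unfolding prob_densities_def using nn_integral_marg[OF order_refl assms] marg_nonneg[OF assms order_refl]
    measurable_marg by blast

text \<open>After splitting the products, the bump contributes its integral over the coordinates
  outside \<open>J\<close>. This is 1 if none of them lies in \<open>I\<close> and 0 otherwise, so
  exactly the marginals with \<open>I \<subseteq> J\<close> are perturbed.\<close>

lemma marg_merge:
  assumes J: "J \<subseteq> {1..d}" and h: "admissible M h"
  shows "integrable (leb ({1..d} - J)) (\<lambda>y. marg M h {1..d} (merge J ({1..d} - J) (x, y)))"
    "marginal d J (marg M h {1..d}) x = marg M h J x"
proof -
  have "has_bochner_integral (leb ({1..d} - J))
      (\<lambda>y. base J x * base ({1..d} - J) y + (M * bump h J x) * bump h ({1..d} - J) y)
      (base J x * 1 + (M * bump h J x) * (if ({1..d} - J) \<inter> I = {} then 1 else 0))"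
    using h by (intro has_bochner_integral_add has_bochner_integral_mult_right has_integral_base has_integral_bump) auto
  moreover have "(({1..d} - J) \<inter> I = {}) = (I \<subseteq> J)" using I_subset by auto
  moreover have "(\<lambda>y. marg M h {1..d} (merge J ({1..d} - J) (x, y))) =
      (\<lambda>y. base J x * base ({1..d} - J) y + (M * bump h J x) * bump h ({1..d} - J) y)"
    unfolding marg_def base_def bump_def using I_subset J by (simp add: gauss_prod_merge mult.assoc)
  ultimately have "has_bochner_integral (leb ({1..d} - J))
      (\<lambda>y. marg M h {1..d} (merge J ({1..d} - J) (x, y))) (marg M h J x)"
    by (simp add: marg_def split: if_splits)
  then show "integrable (leb ({1..d} - J)) (\<lambda>y. marg M h {1..d} (merge J ({1..d} - J) (x, y)))"
    "marginal d J (marg M h {1..d}) x = marg M h J x"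
    by (auto simp: has_bochner_integral_iff marginal_def)
qed

text \<open>No other block contains \<open>I\<close>, so a single factor is perturbed. On the other
  blocks base and bump coincide, so their product can be attached to either summand.\<close>

lemma factorization:
  assumes h: "admissible M h"
  shows "marg M h {1..d} x = (\<Prod>J\<in>\<P>. marg M h J (restrict x J))"
proof -
  have finP: "finite \<P>" using part finite_elements by blast
  have sub: "(if I \<subseteq> J then M else 0) = (if J = I then M else 0)" if "J \<in> \<P>" for J
  proof -
    have "J = I" if "I \<subseteq> J"
    proof (rule ccontr)
      assume "J \<noteq> I"
      then have "J \<inter> I = {}" using part I \<open>J \<in> \<P>\<close> by (auto simp: partition_on_def disjoint_def)
      then show False using \<open>I \<subseteq> J\<close> I_nonempty by auto
    qed
    then show ?thesis by auto
  qed
  have "(\<Prod>J\<in>\<P>. marg M h J (restrict x J)) =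
      marg M h I (restrict x I) * (\<Prod>J\<in>\<P> - {I}. marg M h J (restrict x J))"
    using finP I by (rule prod.remove)
  also have "(\<Prod>J\<in>\<P> - {I}. marg M h J (restrict x J)) = (\<Prod>J\<in>\<P> - {I}. base J x)"
    using sub by (intro prod.cong) (auto simp: marg_def base_def gauss_prod_restrict)
  also have "marg M h I (restrict x I) = base I x + M * bump h I x"
    by (simp add: marg_def base_def bump_def gauss_prod_restrict)
  also have "(base I x + M * bump h I x) * (\<Prod>J\<in>\<P> - {I}. base J x) =
      (\<Prod>J\<in>\<P>. base J x) + M * (bump h I x * (\<Prod>J\<in>\<P> - {I}. base J x))"
    using finP I by (simp add: prod.remove[of \<P> I] algebra_simps)
  also have "(\<Prod>J\<in>\<P> - {I}. base J x) = (\<Prod>J\<in>\<P> - {I}. bump h J x)"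
  proof (intro prod.cong refl)
    fix J assume J: "J \<in> \<P> - {I}"
    then have "J \<inter> I = {}" using part I by (auto simp: partition_on_def disjoint_def)
    then show "base J x = bump h J x"
      unfolding base_def bump_def gauss_prod_def by (intro prod.cong) (auto simp: bump_weight_def bump_poly_def bump_scale_def)
  qed
  also have "bump h I x * (\<Prod>J\<in>\<P> - {I}. bump h J x) = (\<Prod>J\<in>\<P>. bump h J x)"
    using finP I by (rule prod.remove[symmetric])
  finally have "(\<Prod>J\<in>\<P>. marg M h J (restrict x J)) = base {1..d} x + M * bump h {1..d} x"
    unfolding base_def bump_def gauss_prod_partition[OF part finite_atLeastAtMost] .
  moreover have "marg M h {1..d} x = base {1..d} x + M * bump h {1..d} x"
    using I_subset by (simp add: marg_def)
  ultimately show ?thesis by (simp only:)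
qed

section \<open>Membership in the Nikolskii classes\<close>

text \<open>Each coordinate contributes the same power of \<open>\<sigma>\<close>, which is at most
  1. As \<open>J\<close> is nonempty, one such power can be kept and the others dropped.\<close>

lemma base_bound:
  assumes J: "J \<subseteq> {1..d}" "J \<noteq> {}" and q: "1 \<le> (q::ennreal)"
  shows "gauss_prod_bound D J (\<lambda>_. 1 / \<sigma>) (\<lambda>_. \<sigma>) q \<le> R * \<sigma> powr (- (1 - enn2real (1 / q)))"
proof -
  define e where "e = enn2real (1 / q)"
  have e: "0 \<le> e" "e \<le> 1" using exponent_bounds[OF q] by (auto simp: e_def)
  define z where "z = \<sigma> powr (- (1 - e))"
  have z: "0 \<le> z" "z \<le> 1" using \<sigma>(1) e powr_mono[of "-(1-e)" 0 \<sigma>] by (auto simp: z_def)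
  have card: "1 \<le> card J" "card J \<le> d"
    using J finite_subset[OF J(1)] card_mono[of "{1..d}" J] by (auto simp: Suc_le_eq card_gt_0_iff)
  have fac: "1 / \<sigma> * D * (sqrt (8 * pi) * \<sigma>) powr e \<le> (D * sqrt (8 * pi)) * z"
  proof -
    have "sqrt (8 * pi) powr e \<le> sqrt (8 * pi) powr 1" using sqrt_8_pi e by (intro powr_mono) auto
    then have "D * z * sqrt (8 * pi) powr e \<le> D * z * sqrt (8 * pi)"
      using D(1) z sqrt_8_pi by (intro mult_left_mono) auto
    moreover have "\<sigma> powr e = z * \<sigma>"
      using \<sigma>(1) by (simp add: z_def powr_diff powr_minus_divide)
    then have "1 / \<sigma> * D * (sqrt (8 * pi) * \<sigma>) powr e = D * z * sqrt (8 * pi) powr e"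
      using \<sigma>(1) by (simp add: powr_mult mult_ac)
    ultimately show ?thesis by (simp add: mult_ac)
  qed
  have "gauss_prod_bound D J (\<lambda>_. 1 / \<sigma>) (\<lambda>_. \<sigma>) q = (1 / \<sigma> * D * (sqrt (8 * pi) * \<sigma>) powr e) ^ card J"
    by (simp add: gauss_prod_bound_def e_def)
  also have "\<dots> \<le> ((D * sqrt (8 * pi)) * z) ^ card J"
    using fac D(1) \<sigma>(1) by (intro power_mono) auto
  also have "\<dots> = (D * sqrt (8 * pi)) ^ card J * z ^ card J" by (rule power_mult_distrib)
  also have "\<dots> \<le> R * z ^ 1"
  proof (intro mult_mono)
    have "1 * 1 \<le> D * sqrt (8 * pi)" using D(1) sqrt_8_pi by (intro mult_mono) auto
    then show "(D * sqrt (8 * pi)) ^ card J \<le> R"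
      unfolding R_def using card by (intro power_increasing) auto
    show "z ^ card J \<le> z ^ 1" using z card by (intro power_decreasing) auto
  qed (use z norm_const_ge_1 in auto)
  finally show ?thesis by (simp add: z_def e_def)
qed

text \<open>With \<open>e\<close> the reciprocal exponent, a coordinate outside \<open>I\<close>
  contributes at most \<open>\<sigma> powr e / \<sigma> \<le> 1\<close> up to constants, so only the
  bandwidths on \<open>I\<close> remain.\<close>

lemma bump_bound:
  assumes J: "J \<subseteq> {1..d}" "I \<subseteq> J" and h: "admissible M h" and q: "1 \<le> (q::ennreal)"
  shows "gauss_prod_bound D J bump_weight (bump_scale h) q \<le> R * (\<Prod>j\<in>I. h j) powr enn2real (1 / q)"
proof -
  define e where "e = enn2real (1 / q)"
  have e: "0 \<le> e" "e \<le> 1" using exponent_bounds[OF q] by (auto simp: e_def)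
  have finJ: "finite J" using finite_subset[OF J(1)] by simp
  have h': "0 < h j" if "j \<in> I" for j using h that by (auto simp: admissible_def)
  have DC: "1 \<le> D * sqrt (8 * pi)" using mult_mono[of 1 D 1 "sqrt (8 * pi)"] D(1) sqrt_8_pi by auto
  have fac: "bump_weight j * D * (sqrt (8 * pi) * bump_scale h j) powr e \<le> (D * sqrt (8 * pi)) * (if j \<in> I then h j powr e else 1)" for j
  proof -
    have sqe: "sqrt (8 * pi) powr e \<le> sqrt (8 * pi)"
      using powr_mono[of e 1 "sqrt (8 * pi)"] sqrt_8_pi e by auto
    have "bump_weight j * bump_scale h j powr e \<le> (if j \<in> I then h j powr e else 1)"
    proof (cases "j \<in> I")
      case False
      have "\<sigma> powr e \<le> \<sigma> powr 1" using \<sigma>(1) e by (intro powr_mono) auto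
      then show ?thesis using False \<sigma>(1) by (simp add: bump_weight_def bump_scale_def field_simps)
    qed (simp add: bump_weight_def bump_scale_def)
    then have "(D * sqrt (8 * pi) powr e) * (bump_weight j * bump_scale h j powr e) \<le>
        (D * sqrt (8 * pi)) * (if j \<in> I then h j powr e else 1)"
      using D(1) sqe bump_weight_nonneg by (intro mult_mono mult_left_mono) auto
    then show ?thesis by (simp add: powr_mult mult_ac)
  qed
  have "gauss_prod_bound D J bump_weight (bump_scale h) q = (\<Prod>j\<in>J. bump_weight j * D * (sqrt (8 * pi) * bump_scale h j) powr e)"
    by (simp add: gauss_prod_bound_def e_def)
  also have "\<dots> \<le> (\<Prod>j\<in>J. (D * sqrt (8 * pi)) * (if j \<in> I then h j powr e else 1))"
    using fac bump_weight_nonneg D(1) by (intro prod_mono) auto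
  also have "\<dots> = (D * sqrt (8 * pi)) ^ card J * (\<Prod>j\<in>J \<inter> I. h j powr e)"
    using finJ by (simp add: prod.distrib prod.inter_restrict)
  also have "J \<inter> I = I" using J by auto
  also have "(\<Prod>j\<in>I. h j powr e) = (\<Prod>j\<in>I. h j) powr e" by (rule prod_powr_distrib[symmetric])
  also have "(D * sqrt (8 * pi)) ^ card J * (\<Prod>j\<in>I. h j) powr e \<le> R * (\<Prod>j\<in>I. h j) powr e"
    unfolding R_def using DC card_mono[OF _ J(1)] by (intro mult_right_mono power_increasing) auto
  finally show ?thesis by (simp add: e_def)
qed

text \<open>For \<open>i\<close> in \<open>I\<close>, \<open>h i \<le> 1\<close> carries the
  constraint from order \<open>\<beta> i\<close> to order \<open>b\<close>. For \<open>i\<close>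
  outside \<open>I\<close> the relevant scale is \<open>\<sigma> \<ge> 1\<close>, and
  \<open>M \<le> \<kappa>\<close> is enough.\<close>

lemma bump_scaled_bound:
  assumes J: "J \<subseteq> {1..d}" and h: "admissible M h" and i: "i \<in> J" and b: "0 \<le> b" "b \<le> \<beta> i"
  shows "\<bar>if I \<subseteq> J then M else 0\<bar> * (gauss_prod_bound D J bump_weight (bump_scale h) (p i) / bump_scale h i powr b) \<le> R * \<kappa>"
proof (cases "I \<subseteq> J")
  case False
  then show ?thesis using norm_const_ge_1 \<kappa>(1) by auto
next
  case True
  let ?H = "(\<Prod>j\<in>I. h j) powr enn2real (1 / p i)"
  have i': "i \<in> {1..d}" using i J by auto
  have M: "0 \<le> M" "M \<le> \<kappa>" using h by (auto simp: admissible_def)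
  have bspos: "0 < bump_scale h i" by (rule bump_scale_pos[OF h])
  have key: "M * ?H \<le> \<kappa> * bump_scale h i powr b"
  proof (cases "i \<in> I")
    case iI: True
    then have "M * ?H \<le> \<kappa> * h i powr \<beta> i" using h by (simp add: admissible_def)
    also have "\<dots> \<le> \<kappa> * h i powr b"
      using iI h \<kappa>(1) b by (intro mult_left_mono powr_mono') (auto simp: admissible_def)
    finally show ?thesis using iI by (simp add: bump_scale_def)
  next
    case False
    have "0 < (\<Prod>j\<in>I. h j)" "(\<Prod>j\<in>I. h j) \<le> 1"
      using h by (auto simp: admissible_def less_imp_le intro!: prod_pos prod_le_1)
    then have "?H \<le> 1" using exponent_bounds(1)[OF p[OF i']] by (intro powr_le1) auto
    then have "M * ?H \<le> \<kappa> * 1" using M by (intro mult_mono) auto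
    also have "\<dots> \<le> \<kappa> * \<sigma> powr b" using \<kappa>(1) \<sigma>(1) b by (intro mult_left_mono ge_one_powr_ge_zero) auto
    finally show ?thesis using False by (simp add: bump_scale_def)
  qed
  have "M * gauss_prod_bound D J bump_weight (bump_scale h) (p i) \<le> M * (R * ?H)"
    using M J True h p[OF i'] by (intro mult_left_mono bump_bound) auto
  also have "\<dots> \<le> R * (\<kappa> * bump_scale h i powr b)"
    using key norm_const_ge_1 by (simp add: mult.left_commute)
  finally show ?thesis using True M bspos by (simp add: field_simps)
qed

text \<open>Base and bump are each bounded by their half of \<open>L i\<close>, except at order 0
  with \<open>p i = 1\<close>, where their sum is treated as a density.\<close>

lemma marg_mem_nikolskii:
  assumes J: "J \<subseteq> {1..d}" "J \<noteq> {}" and h: "admissible M h"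
  shows "marg M h J \<in> nikolskii J p \<beta> L"
  unfolding marg_def base_def bump_def
proof (rule nikolskii_mix[where K = K and D = D])
  let ?M = "if I \<subseteq> J then M else 0"
  show "finite J" using J finite_subset by blast
  fix i assume i: "i \<in> J"
  then have i': "i \<in> {1..d}" using J by auto
  show "0 < \<beta> i" "sfloor (\<beta> i) \<le> K" "1 \<le> p i" using \<beta> p i' by auto
  have bump_scale: "0 < bump_scale h i" by (rule bump_scale_pos[OF h])
  define e where "e = enn2real (1 / p i)"
  have e: "0 \<le> e" "e \<le> 1" "e = 1 \<Longrightarrow> p i = 1" using exponent_bounds[OF p[OF i']] by (auto simp: e_def)
  have base: "gauss_prod_bound D J (\<lambda>_. 1 / \<sigma>) (\<lambda>_. \<sigma>) (p i) \<le> R * \<sigma> powr (- (1 - e))"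
    using base_bound[OF J p[OF i']] by (simp add: e_def)
  have base_div: "gauss_prod_bound D J (\<lambda>_. 1 / \<sigma>) (\<lambda>_. \<sigma>) (p i) / \<sigma> powr b \<le> R * \<sigma> powr (- b)" for b
  proof -
    have "\<sigma> powr (- (1 - e)) \<le> \<sigma> powr 0" using \<sigma>(1) e by (intro powr_mono) auto
    then have "R * \<sigma> powr (- (1 - e)) \<le> R * 1" using norm_const_ge_1 \<sigma>(1) by (intro mult_left_mono) auto
    then have "gauss_prod_bound D J (\<lambda>_. 1 / \<sigma>) (\<lambda>_. \<sigma>) (p i) \<le> R" using base by simp
    then show ?thesis using \<sigma>(1) by (simp add: powr_minus_divide divide_right_mono)
  qed
  have \<kappa>L: "64 * (R * \<kappa>) \<le> L i" using \<kappa>(2)[OF i'] by (simp add: R_def mult_ac)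
  have R\<kappa>: "0 \<le> R * \<kappa>" using norm_const_ge_1 \<kappa>(1) by simp
  show "32 * (\<bar>1\<bar> * (gauss_prod_bound D J (\<lambda>_. 1 / \<sigma>) (\<lambda>_. \<sigma>) (p i) / \<sigma> powr \<beta> i) +
      \<bar>?M\<bar> * (gauss_prod_bound D J bump_weight (bump_scale h) (p i) / bump_scale h i powr \<beta> i)) \<le> L i"
    using base_div[of "\<beta> i"] \<sigma>(2)[OF i'] bump_scaled_bound[OF J(1) h i, of "\<beta> i"] \<kappa>L \<beta>(1)[OF i']
    by (simp add: R_def mult_ac)
  fix k assume k: "k \<le> sfloor (\<beta> i)"
  show "k = 0 \<and> Lp_norm (leb J) (p i)
        (\<lambda>x. 1 * gauss_prod J (\<lambda>_. 1 / \<sigma>) (\<lambda>_. 1) x0 (\<lambda>_. \<sigma>) x + ?M * gauss_prod J bump_weight bump_poly x0 (bump_scale h) x) \<le> ennreal (L i) \<or>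
      4 * (\<bar>1\<bar> * (gauss_prod_bound D J (\<lambda>_. 1 / \<sigma>) (\<lambda>_. \<sigma>) (p i) / \<sigma> ^ k) +
        \<bar>?M\<bar> * (gauss_prod_bound D J bump_weight (bump_scale h) (p i) / bump_scale h i ^ k)) \<le> L i"
  \<comment> \<open>Here \<open>e = 1\<close> means \<open>p i = 1\<close>: the norm is the total
    mass 1 for every \<open>\<sigma>\<close>, and \<open>L1\<close> gives
    \<open>1 \<le> L i\<close>.\<close>
  proof (cases "k = 0 \<and> e = 1")
    case True
    have "Lp_norm (leb J) (p i) (marg M h J) = epowr (\<integral>\<^sup>+ x. ennreal (marg M h J x) \<partial>leb J) 1"
      using True e(3) marg_nonneg[OF h J(1)] by (simp add: Lp_norm_def)
    also have "\<dots> = 1" unfolding nn_integral_marg[OF J(1) h] by (simp add: epowr_def)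
    also have "1 \<le> ennreal (L i)" using L1[OF i'] True e(3) by (simp add: ennreal_1[symmetric] ennreal_leI del: ennreal_1)
    finally show ?thesis using True by (simp add: marg_def base_def bump_def)
  next
    case False
    have kb: "real k \<le> \<beta> i" using k sfloor_less[OF \<beta>(1)[OF i']] by linarith
    have pow: "\<sigma> ^ k = \<sigma> powr real k" "bump_scale h i ^ k = bump_scale h i powr real k"
      using \<sigma>(1) bump_scale by (auto simp: powr_realpow)
    have "64 * (gauss_prod_bound D J (\<lambda>_. 1 / \<sigma>) (\<lambda>_. \<sigma>) (p i) / \<sigma> ^ k) \<le> L i"
    proof (cases "k = 0")
      case True
      then have "e < 1" using False e by auto
      then show ?thesis using True base \<sigma>(4)[OF i'] by (simp add: e_def R_def mult_ac)
    next
      case False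
      then have "\<sigma> powr (- real k) \<le> \<sigma> powr (- 1)" using \<sigma>(1) by (intro powr_mono) auto
      then have "R * \<sigma> powr (- real k) \<le> R * \<sigma> powr (- 1)" using norm_const_ge_1 by (intro mult_left_mono) auto
      then show ?thesis unfolding pow using base_div[of "real k"] \<sigma>(3)[OF i'] by (simp add: R_def mult_ac)
    qed
    moreover have "\<bar>?M\<bar> * (gauss_prod_bound D J bump_weight (bump_scale h) (p i) / bump_scale h i ^ k) \<le> R * \<kappa>"
      unfolding pow using kb by (intro bump_scaled_bound[OF J(1) h i]) auto
    ultimately have "4 * (\<bar>1\<bar> * (gauss_prod_bound D J (\<lambda>_. 1 / \<sigma>) (\<lambda>_. \<sigma>) (p i) / \<sigma> ^ k) +
        \<bar>?M\<bar> * (gauss_prod_bound D J bump_weight (bump_scale h) (p i) / bump_scale h i ^ k)) \<le> L i"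
      using \<kappa>L R\<kappa> unfolding abs_one mult_1 distrib_left by argo
    then show ?thesis by blast
  qed
qed (use D \<sigma>(1) bump_weight_nonneg bump_scale_pos[OF h] env_bound_base env_bound_bump in auto)

lemma marg_mem:
  assumes h: "admissible M h"
  shows "marg M h {1..d} \<in> nikolskii_indep d p \<beta> L \<P>"
  unfolding nikolskii_indep_def
proof (intro CollectI conjI ballI allI impI)
  show "marg M h {1..d} \<in> prob_densities d" by (rule marg_mem_prob_densities[OF h])
next
  fix x
  have sub: "J \<subseteq> {1..d}" if "J \<in> \<P>" for J using part that by (auto simp: partition_on_def)
  show "marg M h {1..d} x = (\<Prod>J\<in>\<P>. marginal d J (marg M h {1..d}) (restrict x J))"
    unfolding factorization[OF h, of x] by (intro prod.cong refl marg_merge(2)[symmetric] sub h)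
next
  fix J assume J: "J \<subseteq> {1..d} \<and> J \<noteq> {}"
  have "marginal d J (marg M h {1..d}) = marg M h J" using J h by (intro ext marg_merge(2)) auto
  then show "marginal d J (marg M h {1..d}) \<in> nikolskii J p \<beta> L"
    using marg_mem_nikolskii[of J M h] J h by simp
  fix x
  show "integrable (leb ({1..d} - J)) (\<lambda>y. marg M h {1..d} (merge J ({1..d} - J) (x, y)))"
    using J h by (intro marg_merge(1)) auto
qed

section \<open>Chi-square distance, separation and risk\<close>

text \<open>The unperturbed density is the case \<open>M = 0\<close>, so the statements about
  \<open>marg\<close> cover both hypotheses.\<close>

lemma admissible_0: "admissible M h \<Longrightarrow> admissible 0 h"
  using \<kappa>(1) by (auto simp: admissible_def)

text \<open>In the expanded square the linear term integrates to 0, and \<open>bump_le_base\<close>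
  replaces \<open>g^2 / f\<close> by \<open>A * \<bar>g\<bar>\<close>. Only the L^1 norm of the bump
  is left, which \<open>bump_bound\<close> estimates at exponent 1.\<close>

lemma chi_square:
  assumes h: "admissible M h"
  shows "(\<integral>\<^sup>+ x. ennreal ((marg M h {1..d} x)\<^sup>2 / marg 0 h {1..d} x) \<partial>leb {1..d}) \<le>
    ennreal (1 + M\<^sup>2 * A * R * (\<Prod>j\<in>I. h j))"
proof -
  define N where "N = leb {1..d}"
  define f g where "f = base {1..d}" and "g = bump h {1..d}"
  have f: "has_bochner_integral N f 1" unfolding N_def f_def by (rule has_integral_base) simp
  have g: "has_bochner_integral N g 0"
    using has_integral_bump[OF _ h, of "{1..d}"] I_nonempty I_subset by (auto simp: N_def g_def Int_absorb1 split: if_splits)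
  have M: "0 \<le> M" using h by (simp add: admissible_def)
  have H: "0 \<le> (\<Prod>j\<in>I. h j)" using h by (auto simp: admissible_def less_imp_le intro!: prod_nonneg)
  have abs_g: "(\<integral>x. \<bar>g x\<bar> \<partial>N) \<le> R * (\<Prod>j\<in>I. h j)"
  proof -
    have "ennreal (\<integral>x. \<bar>g x\<bar> \<partial>N) = (\<integral>\<^sup>+ x. ennreal \<bar>g x\<bar> \<partial>N)"
      using g by (intro nn_integral_eq_integral[symmetric]) (auto simp: has_bochner_integral_iff)
    also have "\<dots> = Lp_norm N 1 (\<lambda>x. 1 * g x)"
    proof -
      have "epowr v 1 = v" for v by (cases v) (auto simp: epowr_def)
      then show ?thesis by (simp add: Lp_norm_def)
    qed
    also have "\<dots> \<le> ennreal (\<bar>1\<bar> * gauss_prod_bound D {1..d} bump_weight (bump_scale h) 1)"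
      unfolding N_def g_def bump_def using bump_scale_pos[OF h] bump_weight_nonneg D(1) env_bound_bump[of 0]
      by (intro Lp_norm_gauss_prod) auto
    also have "\<dots> \<le> ennreal (R * (\<Prod>j\<in>I. h j))"
      using bump_bound[OF order_refl I_subset h, of 1] H by (intro ennreal_leI) simp
    finally show ?thesis using norm_const_ge_1 H by (subst (asm) ennreal_le_iff) auto
  qed
  define u where "u x = f x + 2 * M * g x + M\<^sup>2 * A * \<bar>g x\<bar>" for x
  have le: "(marg M h {1..d} x)\<^sup>2 / marg 0 h {1..d} x \<le> u x" for x
  proof -
    have pos: "0 < f x" unfolding f_def by (rule base_pos)
    have "(marg M h {1..d} x)\<^sup>2 / marg 0 h {1..d} x = (f x + M * g x)\<^sup>2 / f x"
      using I_subset by (simp add: marg_def f_def g_def)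
    also have "\<dots> = f x + 2 * M * g x + M\<^sup>2 * (\<bar>g x\<bar> / f x * \<bar>g x\<bar>)"
      using pos by (simp add: field_simps power2_eq_square)
    also have "\<dots> \<le> f x + 2 * M * g x + M\<^sup>2 * (A * \<bar>g x\<bar>)"
      using bump_le_base[OF h order_refl, of x] pos
      by (intro add_left_mono mult_left_mono mult_right_mono) (auto simp: f_def g_def field_simps)
    finally show ?thesis by (simp add: u_def mult.assoc)
  qed
  \<comment> \<open>Inherited from the quotient below \<open>u\<close>; it allows the nonnegative
    integral of \<open>u\<close> to be evaluated as a Bochner integral.\<close>
  have nonneg: "0 \<le> u x" for x
  proof -
    have "0 \<le> (marg M h {1..d} x)\<^sup>2 / marg 0 h {1..d} x"
      using marg_nonneg[OF admissible_0[OF h] order_refl, of x] by simp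
    then show ?thesis using le[of x] by linarith
  qed
  have u: "has_bochner_integral N u (1 + 2 * M * 0 + M\<^sup>2 * A * (\<integral>x. \<bar>g x\<bar> \<partial>N))"
    unfolding u_def using f g
    by (intro has_bochner_integral_add has_bochner_integral_mult_right) (auto simp: has_bochner_integral_iff)
  have "(\<integral>\<^sup>+ x. ennreal ((marg M h {1..d} x)\<^sup>2 / marg 0 h {1..d} x) \<partial>N) \<le> (\<integral>\<^sup>+ x. ennreal (u x) \<partial>N)"
    using le by (intro nn_integral_mono ennreal_leI)
  also have "\<dots> = ennreal (1 + M\<^sup>2 * A * (\<integral>x. \<bar>g x\<bar> \<partial>N))"
    using u nonneg by (subst nn_integral_eq_integral) (auto simp: has_bochner_integral_iff)
  also have "\<dots> \<le> ennreal (1 + M\<^sup>2 * A * (R * (\<Prod>j\<in>I. h j)))"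
    using abs_g dom_const_ge_1 by (intro ennreal_leI add_left_mono mult_left_mono) auto
  finally show ?thesis by (simp add: N_def mult_ac)
qed

text \<open>At the centre every profile is evaluated at 0, where its modulus is
  \<open>1 / sqrt (2 * pi)\<close>, and every weight is at least
  \<open>1 / \<sigma>\<close>.\<close>

lemma separation:
  assumes h: "admissible M h"
  shows "M * (1 / (sqrt (2 * pi) * \<sigma>)) ^ d \<le> \<bar>marg M h {1..d} x0 - marg 0 h {1..d} x0\<bar>"
proof -
  have M: "0 \<le> M" using h by (simp add: admissible_def)
  have "(1 / (sqrt (2 * pi) * \<sigma>)) ^ d = (\<Prod>j\<in>{1..d}. 1 / (sqrt (2 * pi) * \<sigma>))" by simp
  also have "\<dots> \<le> (\<Prod>j\<in>{1..d}. bump_weight j * \<bar>gauss_poly (bump_poly j) ((x0 j - x0 j) / bump_scale h j)\<bar>)"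
    using \<sigma>(1) by (intro prod_mono)
      (auto simp: bump_weight_def bump_poly_def gauss_poly_def mexican_def std_normal_density_def field_simps)
  also have "\<dots> = \<bar>bump h {1..d} x0\<bar>"
    using bump_weight_nonneg by (simp add: bump_def gauss_prod_def abs_prod abs_mult)
  finally have "M * (1 / (sqrt (2 * pi) * \<sigma>)) ^ d \<le> M * \<bar>bump h {1..d} x0\<bar>"
    using M by (intro mult_left_mono)
  then show ?thesis using M I_subset by (simp add: marg_def abs_mult)
qed

lemma risk_lower_bound:
  assumes h: "admissible M h" and q: "1 \<le> q" and T: "T \<in> estimators d n"
    and n: "real n * (M\<^sup>2 * A * R * (\<Prod>j\<in>I. h j)) \<le> 1"
  shows "ennreal (M * (1 / (sqrt (2 * pi) * \<sigma>)) ^ d / 32) \<le>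
    max_risk d n q x0 T (nikolskii_indep d p \<beta> L \<P>)"
proof (rule two_point_risk[where ?f0.0 = "marg 0 h {1..d}" and ?f1.0 = "marg M h {1..d}"])
  have "0 \<le> M" "0 \<le> (\<Prod>j\<in>I. h j)" using h by (auto simp: admissible_def less_imp_le intro!: prod_nonneg)
  then show "0 \<le> M\<^sup>2 * A * R * (\<Prod>j\<in>I. h j)" "0 \<le> M * (1 / (sqrt (2 * pi) * \<sigma>)) ^ d"
    using dom_const_ge_1 norm_const_ge_1 \<sigma>(1) by auto
  show "0 < marg 0 h {1..d} x" for x using base_pos by (simp add: marg_def)
qed (use assms admissible_0[OF h] in \<open>blast intro: marg_mem marg_mem_prob_densities chi_square separation\<close>)+

end

section \<open>Rates\<close>

lemma enn2real_inverse_mult: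
  assumes "0 < b" "1 \<le> (p::ennreal)"
  shows "enn2real (1 / (ennreal b * p)) = enn2real (1 / p) / b"
  using assms(2)
proof (cases rule: exponent_cases)
  case 1
  then show ?thesis using assms(1) by (simp add: ennreal_mult_top)
next
  case (2 r)
  have "1 / (ennreal b * p) = ennreal 1 / ennreal (b * r)"
    using 2 assms(1) by (simp add: ennreal_mult)
  also have "\<dots> = ennreal (1 / (b * r))" using 2 assms(1) by (subst divide_ennreal) auto
  finally show ?thesis using 2 assms(1) by simp
qed

section \<open>Choice of height and bandwidths for each sample size\<close>

context perturbation
begin

lemma rate_gamma_I:
  "rate_gamma \<beta> p I = (1 - (\<Sum>i\<in>I. enn2real (1 / p i) / \<beta> i)) / (\<Sum>i\<in>I. 1 / \<beta> i)"
proof -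
  have "(\<Sum>i\<in>I. enn2real (1 / (ennreal (\<beta> i) * p i))) = (\<Sum>i\<in>I. enn2real (1 / p i) / \<beta> i)"
    using I_subset \<beta>(1) p by (intro sum.cong refl enn2real_inverse_mult) auto
  then show ?thesis by (simp add: rate_gamma_def)
qed

lemma sum_inverse_pos: "0 < (\<Sum>i\<in>I. 1 / \<beta> i)"
  using I_subset I_nonempty finite_I \<beta>(1) by (intro sum_pos) auto

text \<open>For either sign of the rate index the bandwidths are powers of one parameter, so that
  their product is read off from the sum of the exponents.\<close>

lemma rate_lower_bound:
  assumes r: "rate_r \<beta> p \<P> = rate_gamma \<beta> p I" and q: "1 \<le> q"
  shows "\<exists>c>0. \<forall>n\<ge>1. \<forall>T\<in>estimators d n.
    ennreal (c * rate_rho n \<beta> p \<P>) \<le> max_risk d n q x0 T (nikolskii_indep d p \<beta> L \<P>)"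
proof -
  define \<tau> where "\<tau> i = enn2real (1 / p i)" for i
  define c0 where "c0 = (1 / (sqrt (2 * pi) * \<sigma>)) ^ d / 32"
  define C where "C = \<kappa>\<^sup>2 * A * R"
  define \<gamma> where "\<gamma> = rate_gamma \<beta> p I"
  define S where "S = (\<Sum>i\<in>I. \<tau> i / \<beta> i)"
  have c0: "0 < c0" using \<sigma>(1) by (simp add: c0_def)
  have C: "0 < C" using \<kappa>(1) dom_const_ge_1 norm_const_ge_1 by (simp add: C_def)
  have \<beta>I: "0 < \<beta> i" if "i \<in> I" for i using that I_subset \<beta>(1) by auto
  have \<tau>: "0 \<le> \<tau> i" if "i \<in> I" for i using exponent_bounds(1)[OF p] that I_subset by (auto simp: \<tau>_def)
  \<comment> \<open>Thus \<open>\<gamma> \<le> 0\<close> forces \<open>S \<ge> 1\<close>; for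
    \<open>\<gamma> > 0\<close> the identity makes the exponents of the bandwidths add up to
    \<open>1 / \<gamma>\<close>.\<close>
  have \<gamma>S: "\<gamma> * (\<Sum>i\<in>I. 1 / \<beta> i) = 1 - S"
    using sum_inverse_pos by (simp add: \<gamma>_def S_def \<tau>_def rate_gamma_I)
  show ?thesis
  proof (cases "\<gamma> \<le> 0")
    case True
    have "S \<ge> 1" using \<gamma>S mult_nonpos_nonneg[OF True, of "\<Sum>i\<in>I. 1 / \<beta> i"] sum_inverse_pos by linarith
    have "ennreal (\<kappa> * c0 * rate_rho n \<beta> p \<P>) \<le> max_risk d n q x0 T (nikolskii_indep d p \<beta> L \<P>)"
      if n: "n \<ge> 1" and T: "T \<in> estimators d n" for n T
    proof -
      \<comment> \<open>The largest \<open>H \<le> 1\<close> with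
        \<open>real n * C * H \<le> 1\<close>.\<close>
      define H where "H = min 1 (1 / (real n * C))"
      have H: "0 < H" "H \<le> 1" using n C by (auto simp: H_def)
      \<comment> \<open>Exponents proportional to \<open>\<tau> i / \<beta> i\<close>, normalised to
        sum 1. Then \<open>h i powr \<beta> i\<close> is \<open>H powr (\<tau> i / S)\<close>, which
        is at least \<open>H powr \<tau> i\<close> because \<open>S \<ge> 1\<close> and
        \<open>H \<le> 1\<close>.\<close>
      define h where "h i = H powr (\<tau> i / \<beta> i / S)" for i
      have prod: "(\<Prod>i\<in>I. h i) = H"
      proof -
        have "(\<Prod>i\<in>I. h i) = H powr (\<Sum>i\<in>I. \<tau> i / \<beta> i / S)"
          unfolding h_def using H finite_I by (intro powr_sum[symmetric]) auto
        also have "(\<Sum>i\<in>I. \<tau> i / \<beta> i / S) = S / S"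
          unfolding S_def by (rule sum_divide_distrib[symmetric])
        also have "S / S = 1" using \<open>S \<ge> 1\<close> by simp
        finally show ?thesis using H by simp
      qed
      have adm: "admissible \<kappa> h"
        unfolding admissible_def prod
      proof (intro conjI ballI)
        fix i assume i: "i \<in> I"
        show "0 < h i" using H by (simp add: h_def)
        show "h i \<le> 1" unfolding h_def using H \<tau>[OF i] \<beta>I[OF i] \<open>S \<ge> 1\<close> by (intro powr_le1) auto
        have "\<tau> i / S \<le> \<tau> i" using \<tau>[OF i] \<open>S \<ge> 1\<close> mult_left_mono[of 1 S "\<tau> i"] by (simp add: divide_le_eq)
        then have "H powr \<tau> i \<le> H powr (\<tau> i / S)" using H by (intro powr_mono') auto
        also have "\<dots> = h i powr \<beta> i" using \<beta>I[OF i] by (simp add: h_def powr_powr)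
        finally show "\<kappa> * H powr enn2real (1 / p i) \<le> \<kappa> * h i powr \<beta> i"
          using \<kappa>(1) by (simp add: \<tau>_def)
      qed (use \<kappa>(1) in auto)
      have "real n * C * H \<le> real n * C * (1 / (real n * C))"
        using C by (intro mult_left_mono) (auto simp: H_def)
      also have "\<dots> \<le> 1" using C by simp
      finally have "ennreal (\<kappa> * (1 / (sqrt (2 * pi) * \<sigma>)) ^ d / 32) \<le>
          max_risk d n q x0 T (nikolskii_indep d p \<beta> L \<P>)"
        using q T by (intro risk_lower_bound[OF adm]) (auto simp: prod C_def mult_ac)
      moreover have "rate_rho n \<beta> p \<P> = 1" using True by (simp add: rate_rho_def r \<gamma>_def)
      ultimately show ?thesis by (simp add: c0_def)
    qed
    then show ?thesis using \<kappa>(1) c0 by (intro exI[of _ "\<kappa> * c0"]) auto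
  next
    case False
    \<comment> \<open>The exponent of the rate, determined by
      \<open>e * (2 + 1 / \<gamma>) = 1\<close>; this cancels \<open>n\<close> in the chi-square
      bound below.\<close>
    define e where "e = \<gamma> / (2 * \<gamma> + 1)"
    \<comment> \<open>The power of \<open>1 / C\<close> normalises the chi-square bound to 1; the
      minimum with 1 keeps \<open>u\<close>, hence every bandwidth, at most 1.\<close>
    define u0 where "u0 = min 1 ((1 / C) powr e)"
    have e: "0 \<le> e" using False by (simp add: e_def)
    have u0: "0 < u0" "u0 \<le> 1" using C by (auto simp: u0_def)
    have ee: "e * (2 + 1 / \<gamma>) = 1"
    proof -
      have "2 + 1 / \<gamma> = (2 * \<gamma> + 1) / \<gamma>" using False by (simp add: field_simps)
      then show ?thesis using False by (simp add: e_def)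
    qed
    have "ennreal (\<kappa> * u0 * c0 * rate_rho n \<beta> p \<P>) \<le> max_risk d n q x0 T (nikolskii_indep d p \<beta> L \<P>)"
      if n: "n \<ge> 1" and T: "T \<in> estimators d n" for n T
    proof -
      define u where "u = u0 * (1 / real n) powr e"
      have "(1 / real n) powr e \<le> 1" using n e by (intro powr_le1) auto
      then have u: "0 < u" "u \<le> 1" using u0 n by (auto simp: u_def intro!: mult_le_one)
      \<comment> \<open>Solves \<open>h i powr \<beta> i = u * (u powr (1 / \<gamma>)) powr \<tau>
        i\<close>, the constraint with equality when the product of the bandwidths is
        \<open>u powr (1 / \<gamma>)\<close>.\<close>
      define h where "h i = u powr (1 / \<beta> i + \<tau> i / \<beta> i / \<gamma>)" for i
      have prod: "(\<Prod>i\<in>I. h i) = u powr (1 / \<gamma>)"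
      proof -
        have "(\<Prod>i\<in>I. h i) = u powr (\<Sum>i\<in>I. 1 / \<beta> i + \<tau> i / \<beta> i / \<gamma>)"
          unfolding h_def using u finite_I by (intro powr_sum[symmetric]) auto
        also have "(\<Sum>i\<in>I. 1 / \<beta> i + \<tau> i / \<beta> i / \<gamma>) = (\<Sum>i\<in>I. 1 / \<beta> i) + S / \<gamma>"
          by (simp add: sum.distrib S_def sum_divide_distrib)
        also have "\<dots> = 1 / \<gamma>" using \<gamma>S False by (simp add: field_simps)
        finally show ?thesis .
      qed
      have adm: "admissible (\<kappa> * u) h"
        unfolding admissible_def prod
      proof (intro conjI ballI)
        fix i assume i: "i \<in> I"
        show "0 < h i" using u by (simp add: h_def)
        show "h i \<le> 1" unfolding h_def using u \<tau>[OF i] \<beta>I[OF i] False by (intro powr_le1) auto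
        have "h i powr \<beta> i = u powr (1 + \<tau> i / \<gamma>)"
          using \<beta>I[OF i] by (simp add: h_def powr_powr distrib_right)
        also have "\<dots> = u * (u powr (1 / \<gamma>)) powr \<tau> i"
          using u by (simp add: powr_add powr_powr)
        finally show "\<kappa> * u * (u powr (1 / \<gamma>)) powr enn2real (1 / p i) \<le> \<kappa> * h i powr \<beta> i"
          by (simp add: \<tau>_def)
      qed (use \<kappa>(1) u in auto)
      have "real n * ((\<kappa> * u)\<^sup>2 * A * R * (\<Prod>i\<in>I. h i)) = real n * C * u powr (2 + 1 / \<gamma>)"
        using u by (simp add: prod C_def powr_add power_mult_distrib mult_ac)
      also have "u powr (2 + 1 / \<gamma>) = u0 powr (2 + 1 / \<gamma>) * (1 / real n)"
        using n by (simp add: u_def powr_mult powr_powr ee)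
      also have "real n * C * (u0 powr (2 + 1 / \<gamma>) * (1 / real n)) = C * u0 powr (2 + 1 / \<gamma>)"
        using n by simp
      also have "\<dots> \<le> C * ((1 / C) powr e) powr (2 + 1 / \<gamma>)"
        using C u0 False by (intro mult_left_mono powr_mono2) (auto simp: u0_def)
      also have "\<dots> = 1" using C by (simp add: powr_powr ee)
      finally have "ennreal (\<kappa> * u * (1 / (sqrt (2 * pi) * \<sigma>)) ^ d / 32) \<le>
          max_risk d n q x0 T (nikolskii_indep d p \<beta> L \<P>)"
        using q T by (intro risk_lower_bound[OF adm])
      moreover have "rate_rho n \<beta> p \<P> = (1 / real n) powr e"
        using False by (simp add: rate_rho_def rate_phi_def r \<gamma>_def e_def)
      ultimately show ?thesis by (simp add: c0_def u_def mult_ac)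
    qed
    then show ?thesis using \<kappa>(1) c0 u0 by (intro exI[of _ "\<kappa> * u0 * c0"]) auto
  qed
qed

end

section \<open>Choice of the constants and conclusion\<close>

lemma eventually_scale_le:
  fixes L Q a :: real
  assumes "0 < L" "0 < a"
  shows "eventually (\<lambda>\<sigma>. Q * \<sigma> powr (- a) \<le> L) at_top"
proof -
  have "((\<lambda>\<sigma>::real. Q * \<sigma> powr (- a)) \<longlongrightarrow> Q * 0) at_top"
    using assms(2) by (intro tendsto_mult tendsto_const tendsto_neg_powr filterlim_ident) auto
  then have "eventually (\<lambda>\<sigma>. Q * \<sigma> powr (- a) < L) at_top"
    using assms(1) by (intro order_tendstoD) auto
  then show ?thesis by eventually_elim simp
qed

text \<open>The constants are fixed in the order \<open>K\<close>, \<open>D\<close>,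
  \<open>\<sigma>\<close>, \<open>\<kappa>\<close>: finitely many polynomials share an envelope
  constant, negative powers of \<open>\<sigma>\<close> tend to 0, and \<open>\<kappa>\<close> is a
  minimum of finitely many positive bounds. The sample size does not enter.\<close>

lemma perturbation_exists:
  assumes \<beta>: "\<forall>i\<in>{1..d}. 0 < \<beta> i" and p: "\<forall>i\<in>{1..d}. 1 \<le> p i"
    and part: "partition_on {1..d} \<P>" and I: "I \<in> \<P>"
    and L: "\<forall>i\<in>{1..d}. 0 < L i"
    and ne: "nikolskii_indep d p \<beta> L \<P> \<noteq> {}"
  shows "\<exists>K D \<sigma> \<kappa>. perturbation d K \<beta> L p \<P> I D \<sigma> \<kappa>"
proof -
  define K where "K = (\<Sum>i\<in>{1..d}. sfloor (\<beta> i))"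
  have K: "sfloor (\<beta> i) \<le> K" if "i \<in> {1..d}" for i
    unfolding K_def using that by (intro member_le_sum) auto
  have "finite ((\<lambda>k. (gauss_step ^^ k) 1) ` {..K} \<union> (\<lambda>k. (gauss_step ^^ k) mexican) ` {..K})" by simp
  from env_bound_finite[OF this] obtain D where D: "1 \<le> D"
      "\<And>k. k \<le> K \<Longrightarrow> env_bound D ((gauss_step ^^ k) 1)" "\<And>k. k \<le> K \<Longrightarrow> env_bound D ((gauss_step ^^ k) mexican)"
    by auto
  define Q where "Q = 64 * (D * sqrt (8 * pi)) ^ d"
  have Q: "0 < Q" using D(1) by (simp add: Q_def)
  let ?good = "\<lambda>\<sigma> i. Q * \<sigma> powr (- \<beta> i) \<le> L i \<and> Q * \<sigma> powr (- 1) \<le> L i \<and>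
    (enn2real (1 / p i) < 1 \<longrightarrow> Q * \<sigma> powr (- (1 - enn2real (1 / p i))) \<le> L i)"
  have "eventually (\<lambda>\<sigma>. ?good \<sigma> i) at_top" if "i \<in> {1..d}" for i
  proof (intro eventually_conj)
    show "eventually (\<lambda>\<sigma>. enn2real (1 / p i) < 1 \<longrightarrow> Q * \<sigma> powr (- (1 - enn2real (1 / p i))) \<le> L i) at_top"
      using that L eventually_scale_le[of "L i" "1 - enn2real (1 / p i)" Q]
      by (cases "enn2real (1 / p i) < 1") auto
  qed (rule eventually_scale_le; use that \<beta> L in simp)+
  then have "eventually (\<lambda>\<sigma>. \<forall>i\<in>{1..d}. ?good \<sigma> i) at_top"
    by (intro eventually_ball_finite) auto
  then have "eventually (\<lambda>\<sigma>. 2 \<le> \<sigma> \<and> (\<forall>i\<in>{1..d}. ?good \<sigma> i)) at_top"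
    by (intro eventually_conj eventually_ge_at_top)
  then obtain \<sigma> where \<sigma>: "2 \<le> \<sigma>" "\<forall>i\<in>{1..d}. ?good \<sigma> i"
    using eventually_happens'[OF trivial_limit_at_top_linorder] by blast
  define Z where "Z = insert (1 / (D * sqrt (2 * pi) * \<sigma>) ^ d) ((\<lambda>i. L i / Q) ` {1..d})"
  define \<kappa> where "\<kappa> = Min Z"
  have Z: "finite Z" "Z \<noteq> {}" by (auto simp: Z_def)
  have base: "0 < (D * sqrt (2 * pi) * \<sigma>) ^ d" using D(1) \<sigma>(1) by simp
  have \<kappa>: "0 < \<kappa>" unfolding \<kappa>_def using Z Q L base by (subst Min_gr_iff) (auto simp: Z_def)
  have le: "\<kappa> \<le> z" if "z \<in> Z" for z unfolding \<kappa>_def using Z(1) that by (rule Min_le)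
  show ?thesis
  proof (intro exI)
    show "perturbation d K \<beta> L p \<P> I D \<sigma> \<kappa>"
    proof
      show "\<kappa> * (D * sqrt (2 * pi) * \<sigma>) ^ d \<le> 1"
        using le[of "1 / (D * sqrt (2 * pi) * \<sigma>) ^ d"] base by (simp add: Z_def pos_le_divide_eq)
      fix i assume i: "i \<in> {1..d}"
      have "\<kappa> \<le> L i / Q" using i by (intro le) (auto simp: Z_def)
      then have "Q * \<kappa> \<le> L i" using Q by (simp add: pos_le_divide_eq mult.commute)
      then show "64 * (D * sqrt (8 * pi)) ^ d * \<kappa> \<le> L i" by (simp only: Q_def)
      \<comment> \<open>Otherwise the class would be empty; this is where nonemptiness
        enters.\<close>
      show "1 \<le> L i" if "p i = 1" using nikolskii_indep_empty[where p = p and L = L, OF i that] ne by force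
      show "64 * (D * sqrt (8 * pi)) ^ d * \<sigma> powr (- (1 - enn2real (1 / p i))) \<le> L i"
        if "enn2real (1 / p i) < 1" using \<sigma>(2) i that by (auto simp: Q_def)
    qed (use assms K D \<sigma> \<kappa> in \<open>auto simp: Q_def\<close>)
  qed
qed

text \<open>On an empty class the maximal risk is a supremum over the empty set, that is 0 in
  \<open>ennreal\<close>, and no positive constant exists; hence the nonemptiness hypothesis. As
  \<open>1 \<le> d\<close>, the partition has a block, and the infimum in \<open>rate_r\<close> is
  attained.\<close>

theorem proposition1:
  fixes d :: nat and q :: real and x0 :: "nat \<Rightarrow> real"
    and \<beta> L :: "nat \<Rightarrow> real" and p :: "nat \<Rightarrow> ennreal" and \<P> :: "nat set set"
  assumes "1 \<le> d" and "1 \<le> q"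
    and "x0 \<in> space (leb {1..d})"
    and "\<forall>i\<in>{1..d}. 0 < \<beta> i"
    and "\<forall>i\<in>{1..d}. 1 \<le> p i"
    and "partition_on {1..d} \<P>"
    and "\<forall>i\<in>{1..d}. 0 < L i"
    and "nikolskii_indep d p \<beta> L \<P> \<noteq> {}"
  shows "\<exists>c::real. c > 0 \<and>
    liminf (\<lambda>n. ennreal (inverse (rate_rho n \<beta> p \<P>)) *
      (INF T\<in>estimators d n. max_risk d n q x0 T (nikolskii_indep d p \<beta> L \<P>)))
    \<ge> ennreal c"
proof -
  have fin: "finite \<P>" using assms(6) finite_elements by blast
  have "\<P> \<noteq> {}" using assms(1,6) by (auto simp: partition_on_def)
  then have "rate_r \<beta> p \<P> \<in> rate_gamma \<beta> p ` \<P>"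
    unfolding rate_r_def using fin by (subst cInf_eq_Min) (auto intro!: Min_in)
  then obtain I where I: "I \<in> \<P>" "rate_r \<beta> p \<P> = rate_gamma \<beta> p I" by blast
  obtain K D \<sigma> \<kappa> where "perturbation d K \<beta> L p \<P> I D \<sigma> \<kappa>"
    using perturbation_exists[OF assms(4-6) I(1) assms(7,8)] by blast
  from perturbation.rate_lower_bound[OF this I(2) assms(2)] obtain c where c: "c > 0"
      "\<And>n T. n \<ge> 1 \<Longrightarrow> T \<in> estimators d n \<Longrightarrow>
        ennreal (c * rate_rho n \<beta> p \<P>) \<le> max_risk d n q x0 T (nikolskii_indep d p \<beta> L \<P>)"
    by blast
  \<comment> \<open>Starting at 1 avoids \<open>n = 0\<close>, where the convention
    \<open>1 / 0 = 0\<close> makes \<open>rate_phi\<close> vanish.\<close>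
  have "ennreal c \<le> ennreal (inverse (rate_rho n \<beta> p \<P>)) *
      (INF T\<in>estimators d n. max_risk d n q x0 T (nikolskii_indep d p \<beta> L \<P>))" if n: "n \<ge> 1" for n
  proof -
    have \<rho>: "0 < rate_rho n \<beta> p \<P>" using n by (simp add: rate_rho_def rate_phi_def)
    have "ennreal c = ennreal (inverse (rate_rho n \<beta> p \<P>)) * ennreal (c * rate_rho n \<beta> p \<P>)"
      using \<rho> c(1) by (simp flip: ennreal_mult)
    also have "\<dots> \<le> ennreal (inverse (rate_rho n \<beta> p \<P>)) *
        (INF T\<in>estimators d n. max_risk d n q x0 T (nikolskii_indep d p \<beta> L \<P>))"
      using c(2)[OF n] by (intro mult_left_mono INF_greatest) auto
    finally show ?thesis .
  qed
  then have "ennreal c \<le> liminf (\<lambda>n. ennreal (inverse (rate_rho n \<beta> p \<P>)) *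
      (INF T\<in>estimators d n. max_risk d n q x0 T (nikolskii_indep d p \<beta> L \<P>)))"
    by (intro Liminf_bounded eventually_sequentiallyI[of 1])
  then show ?thesis using c(1) by blast
qed

end
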